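(* Let $n\ge 2$ and let $M$ be an arbitrary $n$-dimensional immersed submanifold of a Euclidean space. At any point of $M$ where $|H|>0$, and in any orthonormal tangent frame at that point in which $h$ is diagonal with entries $\lambda_1,\dots,\lambda_n$, $$|(\nabla A^-)^-|^2 \ge \frac{2n}{(n+2)(n-1)}\sum_{i=1}^n (|H|-\lambda_i)^2|\nabla_i\nu|^2.$$
   Context: $A$ is the (normal-bundle-valued) second fundamental form of $M$ and $H$ its trace, the mean curvature vector. Where $|H|>0$: $\nu = H/|H|$, $h = \langle A,\nu\rangle$, $A^- = A - h\nu$. The symbol $\nabla$ denotes the induced connections: the Levi-Civita connection on $TM$, the connection $\nabla_X V = (D_XV)^\perp$ on the normal bundle ($D$ the ambient flat connection), and the resulting connection on normal-bundle-valued tensors. In particular $\nabla_i\nu$ is the normal-connection derivative of $\nu$ in direction $e_i$, and $\nabla A^-$ has components $\nabla_iA^-_{jk}$, which are normal vectors. The outer superscript $-$ denotes projection onto the orthogonal complement of $\nu$ in the normal bundle: $(\nabla A^-)^- = \nabla A^- - \langle \nabla A^-,\nu\rangle\nu$. Norms are the natural tensor norms, e.g. $|(\nabla A^-)^-|^2 = \sum_{i,j,k}|(\nabla_iA^-_{jk})^-|^2$. *)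

theory Defs
  imports "HOL-Analysis.Analysis"
begin

section \<open>Smooth maps, smooth manifolds and immersions\<close>

text \<open>Only used on open sets \<open>S\<close>, where the Frechet derivative is unique.\<close>

primrec C_k_on :: "nat \<Rightarrow> ('a::euclidean_space \<Rightarrow> 'b::euclidean_space) \<Rightarrow> 'a set \<Rightarrow> bool" where
  "C_k_on 0 f S \<longleftrightarrow> continuous_on S f"
| "C_k_on (Suc k) f S \<longleftrightarrow>
     (\<forall>x\<in>S. f differentiable (at x)) \<and> (\<forall>a. C_k_on k (\<lambda>x. frechet_derivative f (at x) a) S)"

definition smooth_on :: "('a::euclidean_space \<Rightarrow> 'b::euclidean_space) \<Rightarrow> 'a set \<Rightarrow> bool" where
  "smooth_on f S \<longleftrightarrow> (\<forall>k. C_k_on k f S)"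

text \<open>A chart is a pair of its domain and its coordinate map into \<open>\<real>\<^sup>n\<close>, \<open>n = CARD('n)\<close>.\<close>

type_synonym ('m, 'n) chart = "'m set \<times> ('m \<Rightarrow> real ^ 'n)"

definition smooth_manifold :: "'m topology \<Rightarrow> ('m, 'n::finite) chart set \<Rightarrow> bool" where
  "smooth_manifold M \<A> \<longleftrightarrow>
     Hausdorff_space M \<and> second_countable M \<and>
     (\<Union>(U, \<phi>)\<in>\<A>. U) = topspace M \<and>
     (\<forall>(U, \<phi>)\<in>\<A>. openin M U \<and> open (\<phi> ` U) \<and>
        homeomorphic_map (subtopology M U) (top_of_set (\<phi> ` U)) \<phi>) \<and>
     (\<forall>(U, \<phi>)\<in>\<A>. \<forall>(V, \<psi>)\<in>\<A>. smooth_on (\<psi> \<circ> inv_into U \<phi>) (\<phi> ` (U \<inter> V)))"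

definition smooth_immersion ::
  "('m, 'n::finite) chart set \<Rightarrow> ('m \<Rightarrow> 'b::euclidean_space) \<Rightarrow> bool" where
  "smooth_immersion \<A> F \<longleftrightarrow>
     (\<forall>(U, \<phi>)\<in>\<A>. smooth_on (F \<circ> inv_into U \<phi>) (\<phi> ` U) \<and>
        (\<forall>u\<in>\<phi> ` U. inj (frechet_derivative (F \<circ> inv_into U \<phi>) (at u))))"

definition immersed_submanifold ::
  "'m topology \<Rightarrow> ('m, 'n::finite) chart set \<Rightarrow> ('m \<Rightarrow> 'b::euclidean_space) \<Rightarrow> bool" where
  "immersed_submanifold M \<A> F \<longleftrightarrow> smooth_manifold M \<A> \<and> smooth_immersion \<A> F"

section \<open>Extrinsic geometry of an immersion\<close>

text \<open>
  Below, \<open>X\<close> is the immersion read in a chart and \<open>u\<close> the coordinates of a point of the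
  submanifold. Tangent vectors are identified with their images under \<open>dX\<close>, so tangent and normal
  vectors are both elements of the ambient space; vector fields along the submanifold are
  ambient-valued functions of the coordinates.
\<close>

definition tangent_space :: "(real ^ 'n::finite \<Rightarrow> 'b::euclidean_space) \<Rightarrow> real ^ 'n \<Rightarrow> 'b set" where
  "tangent_space X u = range (frechet_derivative X (at u))"

definition tan_part :: "(real ^ 'n::finite \<Rightarrow> 'b::euclidean_space) \<Rightarrow> real ^ 'n \<Rightarrow> 'b \<Rightarrow> 'b" where
  "tan_part X u w =
     (THE v. v \<in> tangent_space X u \<and> w - v \<in> orthogonal_comp (tangent_space X u))"

definition nor_part :: "(real ^ 'n::finite \<Rightarrow> 'b::euclidean_space) \<Rightarrow> real ^ 'n \<Rightarrow> 'b \<Rightarrow> 'b" where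
  "nor_part X u w = w - tan_part X u w"

text \<open>The coordinates of the tangent vector \<open>e\<close>.\<close>

definition coords :: "(real ^ 'n::finite \<Rightarrow> 'b::euclidean_space) \<Rightarrow> real ^ 'n \<Rightarrow> 'b \<Rightarrow> real ^ 'n" where
  "coords X u e = inv (frechet_derivative X (at u)) e"

text \<open>The ambient flat derivative \<open>D\<^sub>e V\<close> of a field \<open>V\<close> in the direction of the tangent vector \<open>e\<close>.\<close>

definition flat_deriv ::
  "(real ^ 'n::finite \<Rightarrow> 'b::euclidean_space) \<Rightarrow> (real ^ 'n \<Rightarrow> 'b) \<Rightarrow> real ^ 'n \<Rightarrow> 'b \<Rightarrow> 'b" where
  "flat_deriv X V u e = frechet_derivative V (at u) (coords X u e)"

text \<open>The Levi-Civita connection (on tangent fields) and the normal connection (on normal fields).\<close>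

definition tan_conn ::
  "(real ^ 'n::finite \<Rightarrow> 'b::euclidean_space) \<Rightarrow> (real ^ 'n \<Rightarrow> 'b) \<Rightarrow> real ^ 'n \<Rightarrow> 'b \<Rightarrow> 'b" where
  "tan_conn X V u e = tan_part X u (flat_deriv X V u e)"

definition nor_conn ::
  "(real ^ 'n::finite \<Rightarrow> 'b::euclidean_space) \<Rightarrow> (real ^ 'n \<Rightarrow> 'b) \<Rightarrow> real ^ 'n \<Rightarrow> 'b \<Rightarrow> 'b" where
  "nor_conn X V u e = nor_part X u (flat_deriv X V u e)"

text \<open>
  The extension of the tangent vector \<open>e\<close> at \<open>u\<close> to a local tangent field with constant
  coordinates. It serves to evaluate the tensorial expressions below, which do not depend on the
  choice of extension.
\<close>

definition tan_ext ::
  "(real ^ 'n::finite \<Rightarrow> 'b::euclidean_space) \<Rightarrow> real ^ 'n \<Rightarrow> 'b \<Rightarrow> (real ^ 'n \<Rightarrow> 'b)" where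
  "tan_ext X u e = (\<lambda>v. frechet_derivative X (at v) (coords X u e))"

text \<open>\<open>A(e, f) = (D\<^sub>e f)\<^sup>\<bottom>\<close>.\<close>

definition second_ff ::
  "(real ^ 'n::finite \<Rightarrow> 'b::euclidean_space) \<Rightarrow> real ^ 'n \<Rightarrow> 'b \<Rightarrow> 'b \<Rightarrow> 'b" where
  "second_ff X u e f = nor_part X u (flat_deriv X (tan_ext X u f) u e)"

definition coord_vec ::
  "(real ^ 'n::finite \<Rightarrow> 'b::euclidean_space) \<Rightarrow> real ^ 'n \<Rightarrow> 'n \<Rightarrow> 'b" where
  "coord_vec X u i = frechet_derivative X (at u) (axis i 1)"

definition metric_matrix ::
  "(real ^ 'n::finite \<Rightarrow> 'b::euclidean_space) \<Rightarrow> real ^ 'n \<Rightarrow> real ^ 'n ^ 'n" where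
  "metric_matrix X u = (\<chi> i j. coord_vec X u i \<bullet> coord_vec X u j)"

text \<open>
  The metric trace \<open>g\<^sup>i\<^sup>j A\<^sub>i\<^sub>j\<close> of \<open>A\<close>, which equals \<open>\<Sum>i. A(e\<^sub>i, e\<^sub>i)\<close> in any orthonormal tangent frame.
\<close>

definition mean_curv ::
  "(real ^ 'n::finite \<Rightarrow> 'b::euclidean_space) \<Rightarrow> real ^ 'n \<Rightarrow> 'b" where
  "mean_curv X u = (\<Sum>i\<in>UNIV. \<Sum>j\<in>UNIV.
     (matrix_inv (metric_matrix X u) $ i $ j) *\<^sub>R second_ff X u (coord_vec X u i) (coord_vec X u j))"

text \<open>The quantities \<open>\<nu>\<close>, \<open>h\<close> and \<open>A\<^sup>-\<close> are meaningful only where \<open>H \<noteq> 0\<close>, which is an open condition.\<close>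

definition principal_normal ::
  "(real ^ 'n::finite \<Rightarrow> 'b::euclidean_space) \<Rightarrow> real ^ 'n \<Rightarrow> 'b" where
  "principal_normal X u = mean_curv X u /\<^sub>R norm (mean_curv X u)"

definition h_form ::
  "(real ^ 'n::finite \<Rightarrow> 'b::euclidean_space) \<Rightarrow> real ^ 'n \<Rightarrow> 'b \<Rightarrow> 'b \<Rightarrow> real" where
  "h_form X u e f = second_ff X u e f \<bullet> principal_normal X u"

definition A_minus ::
  "(real ^ 'n::finite \<Rightarrow> 'b::euclidean_space) \<Rightarrow> real ^ 'n \<Rightarrow> 'b \<Rightarrow> 'b \<Rightarrow> 'b" where
  "A_minus X u e f = second_ff X u e f - h_form X u e f *\<^sub>R principal_normal X u"

text \<open>
  The induced connection on normal-bundle-valued 2-tensors \<open>B\<close>: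
  \<open>(\<nabla>\<^sub>e B)(f, g) = \<nabla>\<^sub>e (B(f, g)) - B(\<nabla>\<^sub>e f, g) - B(f, \<nabla>\<^sub>e g)\<close>.
\<close>

definition tensor_conn ::
  "(real ^ 'n::finite \<Rightarrow> 'b::euclidean_space) \<Rightarrow> (real ^ 'n \<Rightarrow> 'b \<Rightarrow> 'b \<Rightarrow> 'b) \<Rightarrow>
   real ^ 'n \<Rightarrow> 'b \<Rightarrow> 'b \<Rightarrow> 'b \<Rightarrow> 'b" where
  "tensor_conn X B u e f g =
     nor_conn X (\<lambda>v. B v (tan_ext X u f v) (tan_ext X u g v)) u e
     - B u (tan_conn X (tan_ext X u f) u e) g
     - B u f (tan_conn X (tan_ext X u g) u e)"

text \<open>The outer superscript \<open>-\<close>, for a normal vector \<open>w\<close>.\<close>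

definition minus_part ::
  "(real ^ 'n::finite \<Rightarrow> 'b::euclidean_space) \<Rightarrow> real ^ 'n \<Rightarrow> 'b \<Rightarrow> 'b" where
  "minus_part X u w = w - (w \<bullet> principal_normal X u) *\<^sub>R principal_normal X u"

definition orthonormal_tangent_frame ::
  "(real ^ 'n::finite \<Rightarrow> 'b::euclidean_space) \<Rightarrow> real ^ 'n \<Rightarrow> ('n \<Rightarrow> 'b) \<Rightarrow> bool" where
  "orthonormal_tangent_frame X u e \<longleftrightarrow>
     (\<forall>i. e i \<in> tangent_space X u) \<and> (\<forall>i j. e i \<bullet> e j = (if i = j then 1 else 0))"

end

theory Submission
  imports Defs
begin

text \<open>
  Write \<open>V\<^sub>i = \<nabla>\<^sub>i\<nu>\<close> and \<open>B\<^sub>i\<^sub>j\<^sub>k = (\<nabla>\<^sub>iA\<^sub>j\<^sub>k)\<^sup>-\<close>. Since \<open>A = A\<^sup>- + h\<nu>\<close> and \<open>\<nabla>\<nu>\<close> is orthogonal to \<open>\<nu>\<close>,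
  the tensor to be estimated is \<open>C\<^sub>i\<^sub>j\<^sub>k = (\<nabla>\<^sub>iA\<^sup>-\<^sub>j\<^sub>k)\<^sup>- = B\<^sub>i\<^sub>j\<^sub>k - h\<^sub>j\<^sub>k V\<^sub>i\<close>. By the Codazzi equation \<open>B\<close>
  is symmetric in all three indices, so each of its traces is \<open>(\<nabla>\<^sub>iH)\<^sup>- = |H| V\<^sub>i\<close>, because
  \<open>H = |H|\<nu>\<close>. In a frame that diagonalizes \<open>h\<close> it follows that the trace of \<open>C\<close> over \<open>j, k\<close> vanishes
  (the eigenvalues add up to \<open>|H|\<close>), while both its trace over \<open>i, j\<close> and its trace over \<open>i, k\<close>
  equal \<open>W\<^sub>k = (|H| - \<lambda>\<^sub>k) V\<^sub>k\<close>.

  Only these traces enter the estimate. There is exactly one tensor \<open>T\<close> with the same traces that is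
  built linearly from \<open>W\<close> and the metric; it is orthogonal to \<open>C - T\<close>, hence \<open>|C|\<^sup>2 \<ge> |T|\<^sup>2\<close>, and
  \<open>|T|\<^sup>2 = 2n / ((n+2)(n-1)) |W|\<^sup>2\<close>. This is \<open>three_tensor_norm_ge_traces\<close>.

  The geometric input is therefore the symmetry of \<open>\<nabla>A\<close> (\<open>nabla_II_commute\<close>), the identity
  \<open>\<nabla>\<^sub>cH = \<Sum>\<^sub>k \<nabla>\<^sub>cA(e\<^sub>k, e\<^sub>k)\<close> (\<open>nor_part_dir_deriv_mean_curv\<close>) and the product rule for \<open>A - h\<nu>\<close>
  (\<open>minus_part_tensor_conn_A_minus\<close>). All three are computed in coordinates. A tangent vector is written
  \<open>dir_deriv a X u\<close> with constant coordinates \<open>a\<close>, which makes \<open>A(a, b)\<close> the normal part of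
  \<open>\<partial>\<^sub>a\<partial>\<^sub>bX\<close>, and the Codazzi equation is reduced to the symmetry of the second and third derivatives
  of \<open>X\<close>, proved in \<open>dir_deriv_commute\<close>.
\<close>

section \<open>Directional derivatives and the symmetry of second derivatives\<close>

text \<open>
  The point is the last argument, so that \<open>dir_deriv a f\<close> is again a field, which can be differentiated
  in its turn.
\<close>
definition dir_deriv :: "'a::euclidean_space \<Rightarrow> ('a \<Rightarrow> 'b::euclidean_space) \<Rightarrow> 'a \<Rightarrow> 'b" where
  "dir_deriv a f = (\<lambda>x. frechet_derivative f (at x) a)"

lemma dir_deriv_eqI: "(f has_derivative f') (at x) \<Longrightarrow> dir_deriv a f x = f' a"
  by (metis dir_deriv_def frechet_derivative_at)

lemma has_derivative_dir_deriv:
  "f differentiable (at x) \<Longrightarrow> (f has_derivative (\<lambda>a. dir_deriv a f x)) (at x)"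
  unfolding dir_deriv_def by (simp add: frechet_derivative_works)

lemma linear_dir_deriv: "f differentiable (at x) \<Longrightarrow> linear (\<lambda>a. dir_deriv a f x)"
  using has_derivative_dir_deriv has_derivative_linear by blast

lemma differentiable_cong_open:
  assumes "f differentiable (at x)" "open S" "x \<in> S" "\<And>y. y \<in> S \<Longrightarrow> f y = g y"
  shows "g differentiable (at x)"
proof -
  obtain f' where "(f has_derivative f') (at x)" using assms(1) by (auto simp: differentiable_def)
  then have "(g has_derivative f') (at x)"
    by (rule has_derivative_transform_within_open) (use assms in auto)
  then show ?thesis by (auto simp: differentiable_def)
qed

lemma dir_deriv_cong_open:
  assumes "f differentiable (at x)" "open S" "x \<in> S" "\<And>y. y \<in> S \<Longrightarrow> f y = g y"
  shows "dir_deriv a f x = dir_deriv a g x"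
  unfolding dir_deriv_def using frechet_derivative_transform_within_open[OF assms] by simp

lemma C_k_on_Suc_dir_deriv:
  "C_k_on (Suc k) f S \<longleftrightarrow> (\<forall>x\<in>S. f differentiable (at x)) \<and> (\<forall>a. C_k_on k (dir_deriv a f) S)"
  by (simp add: dir_deriv_def)

lemma C_k_on_differentiable_at:
  assumes "C_k_on k f S" "0 < k" "x \<in> S"
  shows "f differentiable (at x)"
  using assms by (cases k) auto

lemma C_k_on_subset: "C_k_on k f S \<Longrightarrow> T \<subseteq> S \<Longrightarrow> C_k_on k f T"
  by (induction k arbitrary: f) (auto intro: continuous_on_subset)

lemma mvt_along_line:
  fixes g :: "'a::euclidean_space \<Rightarrow> real"
  assumes "0 < t" and diff: "\<And>s. 0 \<le> s \<Longrightarrow> s \<le> t \<Longrightarrow> g differentiable (at (x + s *\<^sub>R a))"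
  obtains s where "0 < s" "s < t" "g (x + t *\<^sub>R a) - g x = t * dir_deriv a g (x + s *\<^sub>R a)"
proof -
  let ?f = "\<lambda>s. g (x + s *\<^sub>R a)"
  have der: "(?f has_derivative (\<lambda>r. r * dir_deriv a g (x + s *\<^sub>R a))) (at s)" if "0 \<le> s" "s \<le> t" for s
  proof -
    have "((\<lambda>s. x + s *\<^sub>R a) has_derivative (\<lambda>r. r *\<^sub>R a)) (at s)"
      by (auto intro!: derivative_eq_intros)
    from diff_chain_at[OF this has_derivative_dir_deriv[OF diff[OF that]]]
    have "(?f has_derivative (\<lambda>r. dir_deriv (r *\<^sub>R a) g (x + s *\<^sub>R a))) (at s)"
      by (simp add: o_def)
    moreover have "dir_deriv (r *\<^sub>R a) g (x + s *\<^sub>R a) = r * dir_deriv a g (x + s *\<^sub>R a)" for r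
      using linear_scale[OF linear_dir_deriv[OF diff[OF that]], of r a] by simp
    ultimately show ?thesis by simp
  qed
  have "continuous_on {0..t} ?f"
    by (intro continuous_at_imp_continuous_on ballI has_derivative_continuous[OF der]) auto
  then obtain s where "0 < s" "s < t" "?f t - ?f 0 = (t - 0) * dir_deriv a g (x + s *\<^sub>R a)"
    by (rule mvt[OF \<open>0 < t\<close>, of ?f "\<lambda>s r. r * dir_deriv a g (x + s *\<^sub>R a)"])
      (auto intro: der)
  with that show thesis by simp
qed

text \<open>
  The second difference of \<open>g\<close> over a small parallelogram is a mixed derivative at a nearby point. Its
  left-hand side is symmetric in \<open>a\<close> and \<open>b\<close>, which is what makes mixed derivatives commute.
\<close>
lemma second_difference_mvt:
  fixes g :: "'a::euclidean_space \<Rightarrow> real"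
  assumes g: "C_k_on 2 g (ball x r)" and t: "0 < t" "t * (norm a + norm b) < r"
  obtains p where "dist p x \<le> t * (norm a + norm b)"
    "g (x + t *\<^sub>R a + t *\<^sub>R b) - g (x + t *\<^sub>R a) - g (x + t *\<^sub>R b) + g x
       = t * t * dir_deriv b (dir_deriv a g) p"
proof -
  have dg: "g differentiable (at y)" "dir_deriv a g differentiable (at y)" if "y \<in> ball x r" for y
    using g that by (auto simp: numeral_2_eq_2 C_k_on_Suc_dir_deriv simp del: C_k_on.simps(2))
  have close: "norm (s *\<^sub>R a + s' *\<^sub>R b) \<le> t * (norm a + norm b)"
    if "0 \<le> s" "s \<le> t" "0 \<le> s'" "s' \<le> t" for s s'
  proof -
    have "norm (s *\<^sub>R a + s' *\<^sub>R b) \<le> s * norm a + s' * norm b"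
      using norm_triangle_ineq[of "s *\<^sub>R a" "s' *\<^sub>R b"] that by simp
    also have "\<dots> \<le> t * norm a + t * norm b"
      using that by (intro add_mono mult_right_mono) auto
    finally show ?thesis by (simp add: algebra_simps)
  qed
  have inb: "x + s *\<^sub>R a + s' *\<^sub>R b \<in> ball x r"
    if "0 \<le> s" "s \<le> t" "0 \<le> s'" "s' \<le> t" for s s'
  proof -
    have "dist x (x + s *\<^sub>R a + s' *\<^sub>R b) = norm (s *\<^sub>R a + s' *\<^sub>R b)"
      by (metis add.assoc add_diff_cancel_left' dist_commute dist_norm)
    with close[OF that] t show ?thesis by simp
  qed
  have inb0: "x + s *\<^sub>R a \<in> ball x r" if "0 \<le> s" "s \<le> t" for s
    using inb[of s 0] that t by simp
  define \<phi> where "\<phi> y = g (y + t *\<^sub>R b) - g y" for y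
  have d\<phi>: "(\<phi> has_derivative (\<lambda>c. dir_deriv c g (y + t *\<^sub>R b) - dir_deriv c g y)) (at y)"
    if "y \<in> ball x r" "y + t *\<^sub>R b \<in> ball x r" for y
  proof -
    have "((\<lambda>y. y + t *\<^sub>R b) has_derivative (\<lambda>c. c)) (at y)"
      by (auto intro!: derivative_eq_intros)
    from diff_chain_at[OF this has_derivative_dir_deriv[OF dg(1)[OF that(2)]]]
    show ?thesis unfolding \<phi>_def
      by (auto simp: o_def intro!: has_derivative_diff has_derivative_dir_deriv dg that)
  qed
  obtain s where s: "0 < s" "s < t" "\<phi> (x + t *\<^sub>R a) - \<phi> x = t * dir_deriv a \<phi> (x + s *\<^sub>R a)"
  proof (rule mvt_along_line[OF \<open>0 < t\<close>, of \<phi> x a])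
    show "\<phi> differentiable (at (x + s *\<^sub>R a))" if "0 \<le> s" "s \<le> t" for s
      using d\<phi>[OF inb0[OF that] inb[OF that, of t]] t by (auto simp: differentiable_def)
  qed
  have eq1: "dir_deriv a \<phi> (x + s *\<^sub>R a)
      = dir_deriv a g (x + s *\<^sub>R a + t *\<^sub>R b) - dir_deriv a g (x + s *\<^sub>R a)"
    using s t by (intro dir_deriv_eqI d\<phi> inb0 inb) auto
  obtain s' where s': "0 < s'" "s' < t"
    "dir_deriv a g (x + s *\<^sub>R a + t *\<^sub>R b) - dir_deriv a g (x + s *\<^sub>R a)
      = t * dir_deriv b (dir_deriv a g) (x + s *\<^sub>R a + s' *\<^sub>R b)"
  proof (rule mvt_along_line[OF \<open>0 < t\<close>, of "dir_deriv a g" "x + s *\<^sub>R a" b])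
    show "dir_deriv a g differentiable (at (x + s *\<^sub>R a + s' *\<^sub>R b))" if "0 \<le> s'" "s' \<le> t" for s'
      using s that by (intro dg inb) auto
  qed
  show thesis
  proof (rule that)
    show "dist (x + s *\<^sub>R a + s' *\<^sub>R b) x \<le> t * (norm a + norm b)"
      using close[of s s'] s s' by (simp add: dist_norm add.assoc)
    show "g (x + t *\<^sub>R a + t *\<^sub>R b) - g (x + t *\<^sub>R a) - g (x + t *\<^sub>R b) + g x
       = t * t * dir_deriv b (dir_deriv a g) (x + s *\<^sub>R a + s' *\<^sub>R b)"
      using s(3) s'(3) eq1 by (simp add: \<phi>_def)
  qed
qed

lemma dir_deriv_commute_real:
  fixes g :: "'a::euclidean_space \<Rightarrow> real"
  assumes S: "open S" "x \<in> S" and g: "C_k_on 2 g S"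
  shows "dir_deriv a (dir_deriv b g) x = dir_deriv b (dir_deriv a g) x"
proof (rule ccontr)
  let ?ab = "dir_deriv a (dir_deriv b g)" and ?ba = "dir_deriv b (dir_deriv a g)"
  assume "?ab x \<noteq> ?ba x"
  define \<epsilon> where "\<epsilon> = \<bar>?ab x - ?ba x\<bar> / 2"
  \<comment> \<open>If the two mixed derivatives differed at \<open>x\<close>, continuity would keep them apart on a small ball,
    while the second difference of a small parallelogram equates their values at two points of it.\<close>
  have "\<epsilon> > 0" using \<open>?ab x \<noteq> ?ba x\<close> by (simp add: \<epsilon>_def)
  have "continuous_on S ?ab" "continuous_on S ?ba"
    using g by (auto simp: numeral_2_eq_2 C_k_on_Suc_dir_deriv simp del: C_k_on.simps(2))
  with S have "isCont ?ab x" "isCont ?ba x" by (auto simp: continuous_on_eq_continuous_at)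
  with \<open>\<epsilon> > 0\<close> obtain d1 d2 where d: "0 < d1" "0 < d2"
    "\<And>y. dist y x < d1 \<Longrightarrow> dist (?ab y) (?ab x) < \<epsilon>" "\<And>y. dist y x < d2 \<Longrightarrow> dist (?ba y) (?ba x) < \<epsilon>"
    unfolding continuous_at_eps_delta by metis
  obtain r where r: "0 < r" "ball x r \<subseteq> S" using S by (auto simp: open_contains_ball)
  have g': "C_k_on 2 g (ball x r)"
    using C_k_on_subset[OF g r(2)] .
  define \<rho> where "\<rho> = min r (min d1 d2)"
  define t where "t = \<rho> / (norm a + norm b + 1)"
  have "\<rho> > 0" using d r by (simp add: \<rho>_def)
  have den: "norm a + norm b + 1 > 0" by (simp add: add_nonneg_pos)
  have t: "0 < t" using \<open>\<rho> > 0\<close> den by (simp add: t_def)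
  have "t * (norm a + norm b) < t * (norm a + norm b + 1)" using t by simp
  also have "\<dots> = \<rho>" using den by (simp add: t_def)
  finally have small: "t * (norm a + norm b) < \<rho>" .
  then have sr: "t * (norm a + norm b) < r" "t * (norm b + norm a) < r" by (auto simp: \<rho>_def add.commute)
  obtain p where p: "dist p x \<le> t * (norm a + norm b)"
    "g (x + t *\<^sub>R a + t *\<^sub>R b) - g (x + t *\<^sub>R a) - g (x + t *\<^sub>R b) + g x = t * t * ?ba p"
    using second_difference_mvt[OF g' t sr(1)] by blast
  obtain q where q: "dist q x \<le> t * (norm b + norm a)"
    "g (x + t *\<^sub>R b + t *\<^sub>R a) - g (x + t *\<^sub>R b) - g (x + t *\<^sub>R a) + g x = t * t * ?ab q"
    using second_difference_mvt[OF g' t sr(2)] by blast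
  have "t * t * ?ba p = t * t * ?ab q"
    using p(2) q(2) by (simp add: algebra_simps)
  then have "?ba p = ?ab q" using t by simp
  moreover have "dist (?ba p) (?ba x) < \<epsilon>" "dist (?ab q) (?ab x) < \<epsilon>"
    using p(1) q(1) small by (auto intro!: d simp: \<rho>_def add.commute)
  ultimately have "dist (?ab x) (?ba x) < 2 * \<epsilon>"
    using dist_triangle3[of "?ab x" "?ba x" "?ab q"] by simp
  then show False by (simp add: \<epsilon>_def dist_real_def)
qed

lemma dir_deriv_inner:
  assumes "f differentiable (at x)"
  shows "dir_deriv a (\<lambda>y. f y \<bullet> w) x = dir_deriv a f x \<bullet> w"
  by (rule dir_deriv_eqI) (rule has_derivative_inner_left, rule has_derivative_dir_deriv, rule assms)

lemma C_k_on_cong: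
  assumes "open S" "\<And>x. x \<in> S \<Longrightarrow> f x = g x" "C_k_on k f S"
  shows "C_k_on k g S"
  using assms(2,3)
proof (induction k arbitrary: f g)
  case 0 then show ?case using continuous_on_cong[of S S f g] by simp
next
  case (Suc k)
  have "g differentiable (at x)" if "x \<in> S" for x
    using C_k_on_differentiable_at[OF Suc.prems(2) _ that] \<open>open S\<close> that Suc.prems(1)
    by (rule differentiable_cong_open) simp
  moreover have "C_k_on k (dir_deriv a g) S" for a
  proof (rule Suc.IH)
    show "C_k_on k (dir_deriv a f) S" using Suc.prems(2) unfolding C_k_on_Suc_dir_deriv by blast
    show "dir_deriv a f x = dir_deriv a g x" if "x \<in> S" for x
      using Suc.prems that \<open>open S\<close> by (intro dir_deriv_cong_open) auto
  qed
  ultimately show ?case unfolding C_k_on_Suc_dir_deriv by blast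
qed

lemma C_k_on_inner:
  assumes "open S" "C_k_on k f S"
  shows "C_k_on k (\<lambda>y. f y \<bullet> w) S"
  using assms(2)
proof (induction k arbitrary: f)
  case 0 then show ?case by (auto intro!: continuous_intros)
next
  case (Suc k)
  have "C_k_on k (dir_deriv a (\<lambda>y. f y \<bullet> w)) S" for a
  proof (rule C_k_on_cong[OF \<open>open S\<close>])
    show "C_k_on k (\<lambda>y. dir_deriv a f y \<bullet> w) S"
      using Suc by (auto simp: C_k_on_Suc_dir_deriv simp del: C_k_on.simps(2))
  qed (use Suc.prems in \<open>simp add: dir_deriv_inner\<close>)
  with Suc.prems show ?case by (auto simp: C_k_on_Suc_dir_deriv simp del: C_k_on.simps(2))
qed

text \<open>
  The mean value theorem is scalar, so the vector-valued case is obtained by testing with all \<open>w\<close>.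
\<close>
theorem dir_deriv_commute:
  assumes S: "open S" "x \<in> S" and f: "C_k_on 2 f S"
  shows "dir_deriv a (dir_deriv b f) x = dir_deriv b (dir_deriv a f) x"
proof (rule vector_eq_rdot[THEN iffD1], rule allI)
  fix w
  have d: "f differentiable (at y)" "dir_deriv c f differentiable (at y)" if "y \<in> S" for y c
    using f that by (auto simp: numeral_2_eq_2 C_k_on_Suc_dir_deriv simp del: C_k_on.simps(2))
  have "dir_deriv a (dir_deriv b (\<lambda>y. f y \<bullet> w)) x = dir_deriv a (dir_deriv b f) x \<bullet> w" for a b
  proof -
    have "dir_deriv a (dir_deriv b f) x \<bullet> w = dir_deriv a (\<lambda>y. dir_deriv b f y \<bullet> w) x"
      using d S by (simp add: dir_deriv_inner)
    also have "\<dots> = dir_deriv a (dir_deriv b (\<lambda>y. f y \<bullet> w)) x"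
      using d S by (intro dir_deriv_cong_open[OF _ S]) (auto simp: dir_deriv_inner)
    finally show ?thesis by simp
  qed
  then show "dir_deriv a (dir_deriv b f) x \<bullet> w = dir_deriv b (dir_deriv a f) x \<bullet> w"
    using dir_deriv_commute_real[OF S C_k_on_inner[OF S(1) f], of a b w] by simp
qed

section \<open>Differentiating the inverse of a matrix\<close>

lemma matrix_inv_inverse:
  assumes "invertible A"
  shows "A ** matrix_inv A = mat 1" "matrix_inv A ** A = mat 1"
  using someI_ex[of "\<lambda>A'. A ** A' = mat 1 \<and> A' ** A = mat 1"] assms
  unfolding invertible_def matrix_inv_def by auto

text \<open>
  Cramer's rule applied to the columns of the inverse. It shows that the entries of the inverse are
  rational, hence differentiable, functions of the entries of the matrix.
\<close>
lemma matrix_inv_eq_cofactor_quotient: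
  fixes A :: "real^'n^'n"
  assumes "det A \<noteq> 0"
  shows "matrix_inv A $ k $ l = det (\<chi> i j. if j = k then axis l 1 $ i else A $ i $ j) / det A"
proof -
  have "invertible A" using assms by (simp add: invertible_det_nz)
  then have "A ** matrix_inv A = mat 1" by (rule matrix_inv_inverse)
  then have "A *v (matrix_inv A *v axis l 1) = axis l 1"
    by (simp add: matrix_vector_mul_assoc)
  then have "matrix_inv A *v axis l 1
      = (\<chi> k. det (\<chi> i j. if j = k then axis l 1 $ i else A $ i $ j) / det A)"
    using cramer[OF assms] by blast
  then have "(matrix_inv A *v axis l 1) $ k
      = det (\<chi> i j. if j = k then axis l 1 $ i else A $ i $ j) / det A" by simp
  then show ?thesis by (simp add: matrix_vector_mul_component inner_axis)
qed

lemma differentiable_prod_real: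
  fixes f :: "'i \<Rightarrow> 'a::real_normed_vector \<Rightarrow> real"
  assumes "\<And>i. i \<in> I \<Longrightarrow> f i differentiable (at x)"
  shows "(\<lambda>y. \<Prod>i\<in>I. f i y) differentiable (at x)"
proof -
  have "\<forall>i\<in>I. \<exists>f'. (f i has_derivative f') (at x)"
    using assms by (auto simp: differentiable_def)
  then obtain f' where "\<And>i. i \<in> I \<Longrightarrow> (f i has_derivative f' i) (at x)" by metis
  then have "((\<lambda>y. \<Prod>i\<in>I. f i y) has_derivative (\<lambda>y. \<Sum>i\<in>I. f' i y * (\<Prod>j\<in>I - {i}. f j x))) (at x)"
    by (rule has_derivative_prod)
  then show ?thesis by (auto simp: differentiable_def)
qed

lemma differentiable_det:
  fixes A :: "'a::real_normed_vector \<Rightarrow> real^'n^'n"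
  assumes "\<And>i j. (\<lambda>y. A y $ i $ j) differentiable (at x)"
  shows "(\<lambda>y. det (A y)) differentiable (at x)"
  unfolding det_def
  by (intro differentiable_sum ballI differentiable_mult differentiable_prod_real differentiable_const
      assms) (simp add: finite_permutations)

lemma differentiable_matrix_inv:
  fixes A :: "'a::real_normed_vector \<Rightarrow> real^'n^'n"
  assumes dA: "\<And>i j. (\<lambda>y. A y $ i $ j) differentiable (at x)"
    and S: "open S" "x \<in> S" and inv: "\<And>y. y \<in> S \<Longrightarrow> invertible (A y)"
  shows "(\<lambda>y. matrix_inv (A y) $ k $ l) differentiable (at x)"
proof -
  let ?q = "\<lambda>y. det (\<chi> i j. if j = k then axis l 1 $ i else A y $ i $ j) / det (A y)"
  have "?q differentiable (at x)"
  proof (intro differentiable_divide differentiable_det dA)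
    show "(\<lambda>y. (\<chi> i j. if j = k then axis l 1 $ i else A y $ i $ j) $ i $ j) differentiable (at x)" for i j
      using dA by (cases "j = k") auto
    show "det (A x) \<noteq> 0" using inv S by (simp add: invertible_det_nz)
  qed
  moreover have "?q y = matrix_inv (A y) $ k $ l" if "y \<in> S" for y
    using inv[OF that] by (simp add: matrix_inv_eq_cofactor_quotient invertible_det_nz)
  ultimately show ?thesis by (rule differentiable_cong_open[OF _ S])
qed

text \<open>
  The entries of \<open>(A\<^sup>-\<^sup>1)' = - A\<^sup>-\<^sup>1 A' A\<^sup>-\<^sup>1\<close>, from the product rule for \<open>A\<^sup>-\<^sup>1 A = 1\<close>.
\<close>
lemma dir_deriv_matrix_inv:
  fixes A :: "'a::euclidean_space \<Rightarrow> real^'n^'n"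
  assumes dA: "\<And>i j. (\<lambda>y. A y $ i $ j) differentiable (at x)"
    and S: "open S" "x \<in> S" and inv: "\<And>y. y \<in> S \<Longrightarrow> invertible (A y)"
  shows "dir_deriv c (\<lambda>y. matrix_inv (A y) $ k $ l) x
     = - (\<Sum>i\<in>UNIV. \<Sum>j\<in>UNIV. matrix_inv (A x) $ k $ i * dir_deriv c (\<lambda>y. A y $ i $ j) x
            * matrix_inv (A x) $ j $ l)"
proof -
  define B where "B y = matrix_inv (A y)" for y
  have dB: "(\<lambda>y. B y $ i $ j) differentiable (at x)" for i j
    unfolding B_def by (rule differentiable_matrix_inv[OF dA S inv])
  define A' B' where "A' = (\<chi> i j. dir_deriv c (\<lambda>y. A y $ i $ j) x)"
    and "B' = (\<chi> i j. dir_deriv c (\<lambda>y. B y $ i $ j) x)"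
  have BA: "B y ** A y = mat 1" "A y ** B y = mat 1" if "y \<in> S" for y
    using inv[OF that] unfolding B_def by (simp_all add: matrix_inv_inverse)
  have "B' ** A x + B x ** A' = 0"
  proof (simp add: vec_eq_iff, intro allI)
    fix i j
    let ?f = "\<lambda>y. (B y ** A y) $ i $ j"
    have "(?f has_derivative
        (\<lambda>c. \<Sum>k\<in>UNIV. B x $ i $ k * dir_deriv c (\<lambda>y. A y $ k $ j) x
           + dir_deriv c (\<lambda>y. B y $ i $ k) x * A x $ k $ j)) (at x)"
      unfolding matrix_matrix_mult_def
      by (simp, intro has_derivative_sum has_derivative_mult has_derivative_dir_deriv dA dB)
    from dir_deriv_eqI[OF this, of c]
    have "dir_deriv c ?f x = (B' ** A x) $ i $ j + (B x ** A') $ i $ j"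
      by (simp add: matrix_matrix_mult_def A'_def B'_def sum.distrib)
    moreover have "dir_deriv c ?f x = dir_deriv c (\<lambda>y. (mat 1 :: real^'n^'n) $ i $ j) x"
      using BA by (intro dir_deriv_cong_open[symmetric, OF _ S]) auto
    ultimately show "(B' ** A x) $ i $ j + (B x ** A') $ i $ j = 0"
      by (simp add: dir_deriv_def)
  qed
  then have "B' ** A x = - (B x ** A')" by (simp add: eq_neg_iff_add_eq_0)
  then have "B' ** A x ** B x = - (B x ** A' ** B x)"
    by (simp add: matrix_matrix_mult_def vec_eq_iff sum_negf)
  then have "B' = - (B x ** A' ** B x)"
    using BA(2)[OF S(2)] by (simp flip: matrix_mul_assoc)
  then have "B' $ k $ l = - (\<Sum>j\<in>UNIV. (\<Sum>i\<in>UNIV. B x $ k $ i * A' $ i $ j) * B x $ j $ l)"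
    by (simp add: matrix_matrix_mult_def)
  also have "\<dots> = - (\<Sum>i\<in>UNIV. \<Sum>j\<in>UNIV. B x $ k $ i * A' $ i $ j * B x $ j $ l)"
    by (subst sum.swap) (simp add: sum_distrib_right)
  finally show ?thesis by (simp add: A'_def B'_def B_def)
qed

section \<open>A lower bound for the norm of a 3-tensor in terms of its traces\<close>

text \<open>
  The tensor \<open>T\<^sub>i\<^sub>j\<^sub>k = a \<delta>\<^sub>j\<^sub>k W\<^sub>i + b (\<delta>\<^sub>i\<^sub>j W\<^sub>k + \<delta>\<^sub>i\<^sub>k W\<^sub>j)\<close> pairs with any tensor through the traces of the
  latter only. With \<open>a\<close> and \<open>b\<close> chosen such that \<open>T\<close> has the traces of \<open>C\<close>, the pairings \<open>\<langle>C, T\<rangle>\<close>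
  and \<open>\<langle>T, T\<rangle>\<close> therefore agree, and \<open>0 \<le> |C - T|\<^sup>2 = |C|\<^sup>2 - |T|\<^sup>2\<close>.
\<close>
lemma three_tensor_norm_ge_traces:
  fixes C :: "'n::finite \<Rightarrow> 'n \<Rightarrow> 'n \<Rightarrow> 'b::real_inner" and W :: "'n \<Rightarrow> 'b" and n :: real
  assumes n: "n = real CARD('n)" "CARD('n) \<ge> 2"
    and tr_jk: "\<And>i. (\<Sum>k\<in>UNIV. C i k k) = 0"
    and tr_ij: "\<And>k. (\<Sum>i\<in>UNIV. C i i k) = W k"
    and tr_ik: "\<And>k. (\<Sum>i\<in>UNIV. C i k i) = W k"
  shows "(\<Sum>i\<in>UNIV. \<Sum>j\<in>UNIV. \<Sum>k\<in>UNIV. (norm (C i j k))\<^sup>2)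
     \<ge> 2 * n / ((n + 2) * (n - 1)) * (\<Sum>k\<in>UNIV. (norm (W k))\<^sup>2)"
proof -
  define b a where "b = n / ((n + 2) * (n - 1))" and "a = - 2 * b / n"
  have n2: "n \<ge> 2" using n by simp
  \<comment> \<open>The two conditions say that the \<open>jk\<close>-trace of \<open>T\<close> is \<open>0\<close> and its other two traces are \<open>W\<close>.\<close>
  have ab: "n * a + 2 * b = 0" "a + n * b + b = 1"
    using n2 unfolding a_def b_def by (auto simp: divide_simps) (auto simp: algebra_simps)
  define T where "T i j k = (if j = k then a *\<^sub>R W i else 0) + (if i = j then b *\<^sub>R W k else 0)
      + (if i = k then b *\<^sub>R W j else 0)" for i j k
  have T: "(\<Sum>k\<in>UNIV. T i k k) = 0" "(\<Sum>i\<in>UNIV. T i i k) = W k" "(\<Sum>i\<in>UNIV. T i k i) = W k" for i k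
  proof -
    have "(\<Sum>k\<in>UNIV. T i k k) = (n * a + 2 * b) *\<^sub>R W i"
      by (simp add: T_def sum.distrib n scaleR_add_left scaleR_2 sum_constant_scaleR flip: scaleR_scaleR)

    then show "(\<Sum>k\<in>UNIV. T i k k) = 0" using ab by simp
    have "(\<Sum>i\<in>UNIV. T i i k) = (a + n * b + b) *\<^sub>R W k"
      by (simp add: T_def sum.distrib n scaleR_add_left scaleR_2 sum_constant_scaleR flip: scaleR_scaleR)

    then show "(\<Sum>i\<in>UNIV. T i i k) = W k" using ab by simp
    have "(\<Sum>i\<in>UNIV. T i k i) = (a + n * b + b) *\<^sub>R W k"
      by (simp add: T_def sum.distrib n scaleR_add_left scaleR_2 sum_constant_scaleR flip: scaleR_scaleR)

    then show "(\<Sum>i\<in>UNIV. T i k i) = W k" using ab by simp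
  qed
  have inner_T: "(\<Sum>i\<in>UNIV. \<Sum>j\<in>UNIV. \<Sum>k\<in>UNIV. D i j k \<bullet> T i j k) = 2 * b * (\<Sum>k\<in>UNIV. (norm (W k))\<^sup>2)"
    if "\<And>i. (\<Sum>k\<in>UNIV. D i k k) = 0" "\<And>k. (\<Sum>i\<in>UNIV. D i i k) = W k" "\<And>k. (\<Sum>i\<in>UNIV. D i k i) = W k"
    for D
  proof -
    have "D i j k \<bullet> T i j k = (if j = k then a * (D i k k \<bullet> W i) else 0)
        + (if i = j then b * (D i i k \<bullet> W k) else 0) + (if i = k then b * (D i j i \<bullet> W j) else 0)" for i j k
      by (auto simp: T_def inner_add_right)
    moreover have "(\<Sum>j\<in>UNIV. \<Sum>k\<in>UNIV. if i = j then f j k else 0) = (\<Sum>k\<in>UNIV. f i k)"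
      for i :: 'n and f :: "'n \<Rightarrow> 'n \<Rightarrow> real"
      by (subst sum.swap) simp
    ultimately have "(\<Sum>i\<in>UNIV. \<Sum>j\<in>UNIV. \<Sum>k\<in>UNIV. D i j k \<bullet> T i j k)
       = (\<Sum>i\<in>UNIV. \<Sum>k\<in>UNIV. a * (D i k k \<bullet> W i)) + (\<Sum>i\<in>UNIV. \<Sum>k\<in>UNIV. b * (D i i k \<bullet> W k))
         + (\<Sum>i\<in>UNIV. \<Sum>j\<in>UNIV. b * (D i j i \<bullet> W j))"
      by (simp add: sum.distrib)
    also have "(\<Sum>i\<in>UNIV. \<Sum>k\<in>UNIV. a * (D i k k \<bullet> W i)) = a * (\<Sum>i\<in>UNIV. (\<Sum>k\<in>UNIV. D i k k) \<bullet> W i)"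
      by (simp only: inner_sum_left sum_distrib_left)
    also have "(\<Sum>i\<in>UNIV. \<Sum>k\<in>UNIV. b * (D i i k \<bullet> W k)) = b * (\<Sum>k\<in>UNIV. (\<Sum>i\<in>UNIV. D i i k) \<bullet> W k)"
      by (subst sum.swap) (simp only: inner_sum_left sum_distrib_left)
    also have "(\<Sum>i\<in>UNIV. \<Sum>j\<in>UNIV. b * (D i j i \<bullet> W j)) = b * (\<Sum>j\<in>UNIV. (\<Sum>i\<in>UNIV. D i j i) \<bullet> W j)"
      by (subst sum.swap) (simp only: inner_sum_left sum_distrib_left)
    finally show ?thesis by (simp add: that power2_norm_eq_inner)
  qed
  have "0 \<le> (\<Sum>i\<in>UNIV. \<Sum>j\<in>UNIV. \<Sum>k\<in>UNIV. (norm (C i j k - T i j k))\<^sup>2)"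
    by (intro sum_nonneg) auto
  also have "\<dots> = (\<Sum>i\<in>UNIV. \<Sum>j\<in>UNIV. \<Sum>k\<in>UNIV. (norm (C i j k))\<^sup>2)
      + (\<Sum>i\<in>UNIV. \<Sum>j\<in>UNIV. \<Sum>k\<in>UNIV. T i j k \<bullet> T i j k)
      - 2 * (\<Sum>i\<in>UNIV. \<Sum>j\<in>UNIV. \<Sum>k\<in>UNIV. C i j k \<bullet> T i j k)"
    by (simp add: power2_norm_eq_inner inner_diff_left inner_diff_right inner_commute[of "T _ _ _" "C _ _ _"]
        sum.distrib sum_subtractf sum_distrib_left)
  also have "\<dots> = (\<Sum>i\<in>UNIV. \<Sum>j\<in>UNIV. \<Sum>k\<in>UNIV. (norm (C i j k))\<^sup>2) - 2 * b * (\<Sum>k\<in>UNIV. (norm (W k))\<^sup>2)"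
    using inner_T[OF tr_jk tr_ij tr_ik] inner_T[of T, OF T] by simp
  finally show ?thesis by (simp add: b_def)
qed

section \<open>Tangential and normal projections of an immersion\<close>

lemma C_k_on_Suc_imp: "C_k_on (Suc k) f S \<Longrightarrow> C_k_on k f S"
proof (induction k arbitrary: f)
  case 0
  then show ?case
    by (auto intro!: continuous_at_imp_continuous_on differentiable_imp_continuous_within)
next
  case (Suc k)
  then show ?case by (metis C_k_on_Suc_dir_deriv)
qed

lemma linear_axis_expansion:
  fixes f :: "real^'n \<Rightarrow> 'b::real_vector"
  assumes "linear f"
  shows "f a = (\<Sum>i\<in>UNIV. a $ i *\<^sub>R f (axis i 1))"
proof -
  have "f a = f (\<Sum>i\<in>UNIV. a $ i *\<^sub>R axis i 1)"
    by (metis basis_expansion scalar_mult_eq_scaleR)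
  also have "\<dots> = (\<Sum>i\<in>UNIV. a $ i *\<^sub>R f (axis i 1))"
    using assms by (simp add: linear_sum linear_scale)
  finally show ?thesis .
qed

text \<open>
  An immersion read in a chart. The covariant derivative of the second fundamental form involves
  three derivatives of \<open>X\<close>.
\<close>
locale immersed_patch =
  fixes X :: "real ^ 'n::finite \<Rightarrow> 'b::euclidean_space" and S :: "(real ^ 'n) set"
  assumes open_S: "open S"
    and C3: "C_k_on 3 X S"
    and inj_deriv: "\<And>v. v \<in> S \<Longrightarrow> inj (frechet_derivative X (at v))"
begin

lemma C_k_on_dir_deriv: "C_k_on 2 X S" "C_k_on 2 (dir_deriv a X) S" "C_k_on 1 (dir_deriv a (dir_deriv b X)) S"
proof -
  have "C_k_on (Suc 2) X S" using C3 by simp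
  then show "C_k_on 2 X S" by (rule C_k_on_Suc_imp)
  show *: "C_k_on 2 (dir_deriv a X) S" for a
    using \<open>C_k_on (Suc 2) X S\<close> unfolding C_k_on_Suc_dir_deriv by blast
  have "C_k_on (Suc 1) (dir_deriv b X) S" using *[of b] by (simp add: numeral_2_eq_2)
  then show "C_k_on 1 (dir_deriv a (dir_deriv b X)) S" unfolding C_k_on_Suc_dir_deriv by blast
qed

lemma differentiable_X:
  assumes "v \<in> S"
  shows "X differentiable (at v)" "dir_deriv a X differentiable (at v)"
    "dir_deriv a (dir_deriv b X) differentiable (at v)"
  using assms C_k_on_dir_deriv[THEN C_k_on_differentiable_at] by auto

text \<open>
  The third derivative is symmetric in its first two slots by the symmetry for \<open>dir_deriv b X\<close> at
  \<open>v\<close>, and in its last two slots because the symmetry for \<open>X\<close> holds on a neighbourhood of \<open>v\<close>.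
\<close>
lemma commute_X:
  assumes "v \<in> S"
  shows "dir_deriv a (dir_deriv b X) v = dir_deriv b (dir_deriv a X) v"
    and "dir_deriv c (dir_deriv a (dir_deriv b X)) v = dir_deriv a (dir_deriv c (dir_deriv b X)) v"
    and "dir_deriv c (dir_deriv a (dir_deriv b X)) v = dir_deriv c (dir_deriv b (dir_deriv a X)) v"
proof -
  have *: "dir_deriv a (dir_deriv b X) v = dir_deriv b (dir_deriv a X) v" if "v \<in> S" for v
    by (rule dir_deriv_commute[OF open_S that C_k_on_dir_deriv(1)])
  then show "dir_deriv a (dir_deriv b X) v = dir_deriv b (dir_deriv a X) v" using assms .
  show "dir_deriv c (dir_deriv a (dir_deriv b X)) v = dir_deriv a (dir_deriv c (dir_deriv b X)) v"
    by (rule dir_deriv_commute[OF open_S assms C_k_on_dir_deriv(2)])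
  show "dir_deriv c (dir_deriv a (dir_deriv b X)) v = dir_deriv c (dir_deriv b (dir_deriv a X)) v"
    by (rule dir_deriv_cong_open[OF _ open_S assms *]) (use differentiable_X assms in auto)
qed

lemma linear_dX: "v \<in> S \<Longrightarrow> linear (\<lambda>a. dir_deriv a X v)"
  by (simp add: differentiable_X linear_dir_deriv)

lemma bilinear_ddX: "v \<in> S \<Longrightarrow> bilinear (\<lambda>a b. dir_deriv a (dir_deriv b X) v)"
proof -
  assume v: "v \<in> S"
  have lin: "linear (\<lambda>a. dir_deriv a (dir_deriv b X) v)" for b
    using v by (simp add: differentiable_X linear_dir_deriv)
  with commute_X(1)[OF v] show ?thesis unfolding bilinear_def by simp
qed

lemma bilinear_dddX: "v \<in> S \<Longrightarrow> bilinear (\<lambda>a b. dir_deriv c (dir_deriv a (dir_deriv b X)) v)"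
  unfolding bilinear_def
proof (intro conjI allI)
  fix b
  assume v: "v \<in> S"
  have lin: "linear (\<lambda>a. dir_deriv c (dir_deriv a (dir_deriv b X)) v)" for b
    using v by (subst commute_X) (auto intro: linear_dir_deriv differentiable_X)
  then show "linear (\<lambda>a. dir_deriv c (dir_deriv a (dir_deriv b X)) v)" .
  show "linear (\<lambda>a. dir_deriv c (dir_deriv b (dir_deriv a X)) v)"
    using lin[of b] v by (subst commute_X(3)) auto
qed

lemma coords_dX [simp]: "v \<in> S \<Longrightarrow> coords X v (dir_deriv a X v) = a"
  by (simp add: coords_def dir_deriv_def inv_f_f inj_deriv)

lemma tangent_space_eq: "tangent_space X v = range (\<lambda>a. dir_deriv a X v)"
  by (simp add: tangent_space_def dir_deriv_def)

lemma metric_matrix_nth: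
  "metric_matrix X v $ i $ j = dir_deriv (axis i 1) X v \<bullet> dir_deriv (axis j 1) X v"
  by (simp add: metric_matrix_def coord_vec_def dir_deriv_def)

lemma inner_metric:
  assumes "v \<in> S"
  shows "a \<bullet> (metric_matrix X v *v b) = dir_deriv a X v \<bullet> dir_deriv b X v"
  unfolding linear_axis_expansion[OF linear_dX[OF assms], of a]
    linear_axis_expansion[OF linear_dX[OF assms], of b]
  by (simp add: inner_vec_def matrix_vector_mult_def metric_matrix_nth inner_sum_left inner_sum_right
      sum_distrib_left mult.commute mult.left_commute) (rule sum.swap)

lemma invertible_metric:
  assumes "v \<in> S"
  shows "invertible (metric_matrix X v)"
proof -
  have "a = 0" if "metric_matrix X v *v a = 0" for a
  proof -
    have "dir_deriv a X v = 0" using inner_metric[OF assms, of a a] that by simp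
    then have "dir_deriv a X v = dir_deriv 0 X v"
      using linear_0[OF linear_dX[OF assms]] by simp
    then show "a = 0" by (metis assms coords_dX)
  qed
  then show ?thesis
    by (simp add: invertible_left_inverse matrix_left_invertible_ker)
qed

text \<open>
  The coordinates \<open>g\<^sup>i\<^sup>j \<langle>w, X\<^sub>j\<rangle>\<close> of the tangential part of \<open>w\<close>. Unlike the description of \<open>tan_part\<close>
  by orthogonality, this formula can be differentiated in the base point.
\<close>
definition tan_coeff :: "real^'n \<Rightarrow> 'b \<Rightarrow> real^'n" where
  "tan_coeff v w = matrix_inv (metric_matrix X v) *v (\<chi> j. w \<bullet> dir_deriv (axis j 1) X v)"

lemma inner_dX_tan_coeff:
  assumes "v \<in> S"
  shows "dir_deriv (tan_coeff v w) X v \<bullet> dir_deriv a X v = w \<bullet> dir_deriv a X v"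
proof -
  have "dir_deriv (tan_coeff v w) X v \<bullet> dir_deriv a X v
      = a \<bullet> (metric_matrix X v *v tan_coeff v w)"
    by (simp add: inner_metric assms inner_commute)
  also have "\<dots> = a \<bullet> (\<chi> j. w \<bullet> dir_deriv (axis j 1) X v)"
    by (simp add: tan_coeff_def matrix_vector_mul_assoc matrix_inv_inverse invertible_metric assms)
  also have "\<dots> = w \<bullet> dir_deriv a X v"
    unfolding linear_axis_expansion[OF linear_dX[OF assms], of a]
    by (simp add: inner_vec_def inner_sum_right)
  finally show ?thesis .
qed

lemma tan_part_unique:
  assumes v: "v \<in> S" and "\<And>b. (w - dir_deriv a X v) \<bullet> dir_deriv b X v = 0"
  shows "tan_part X v w = dir_deriv a X v"
  unfolding tan_part_def
proof (rule the_equality)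
  show "dir_deriv a X v \<in> tangent_space X v \<and> w - dir_deriv a X v \<in> (tangent_space X v)\<^sup>\<bottom>"
    using assms(2) by (auto simp: tangent_space_eq orthogonal_comp_def orthogonal_def inner_commute)
next
  fix t
  assume "t \<in> tangent_space X v \<and> w - t \<in> (tangent_space X v)\<^sup>\<bottom>"
  then obtain c where t: "t = dir_deriv c X v" and "\<And>b. (w - t) \<bullet> dir_deriv b X v = 0"
    by (auto simp: tangent_space_eq orthogonal_comp_def orthogonal_def inner_commute)
  with assms(2) have "(t - dir_deriv a X v) \<bullet> dir_deriv b X v = 0" for b
    by (metis (no_types, lifting) diff_add_cancel diff_diff_eq2 eq_iff_diff_eq_0 inner_diff_left)
  moreover have "t - dir_deriv a X v = dir_deriv (c - a) X v"
    using linear_diff[OF linear_dX[OF v]] t by simp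
  ultimately have "t - dir_deriv a X v = 0" by (metis inner_eq_zero_iff)
  then show "t = dir_deriv a X v" by simp
qed

lemma tan_part_eq: "v \<in> S \<Longrightarrow> tan_part X v w = dir_deriv (tan_coeff v w) X v"
  by (rule tan_part_unique) (auto simp: inner_diff_left inner_dX_tan_coeff)

lemma nor_part_eq: "v \<in> S \<Longrightarrow> nor_part X v w = w - dir_deriv (tan_coeff v w) X v"
  by (simp add: nor_part_def tan_part_eq)

lemma linear_tan_coeff: "linear (tan_coeff v)"
  unfolding tan_coeff_def
  by (rule linear_compose[OF _ matrix_vector_mul_linear, unfolded o_def])
    (auto intro!: linearI simp: vec_eq_iff inner_add_left)

lemma linear_nor_part:
  assumes "v \<in> S"
  shows "linear (nor_part X v)"
proof -
  have "linear (\<lambda>w. w - dir_deriv (tan_coeff v w) X v)"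
    by (intro linear_compose_sub linear_ident
        linear_compose[OF linear_tan_coeff linear_dX[OF assms], unfolded o_def])
  then show ?thesis by (simp add: nor_part_eq[OF assms, abs_def])
qed

lemma nor_part_dX [simp]: "v \<in> S \<Longrightarrow> nor_part X v (dir_deriv a X v) = 0"
  using tan_part_unique[of v "dir_deriv a X v" a] by (simp add: nor_part_def)

lemma inner_nor_part_dX [simp]: "v \<in> S \<Longrightarrow> nor_part X v w \<bullet> dir_deriv a X v = 0"
  by (simp add: nor_part_eq inner_diff_left inner_dX_tan_coeff)

lemma nor_part_of_normal:
  assumes "v \<in> S" "\<And>a. w \<bullet> dir_deriv a X v = 0"
  shows "nor_part X v w = w"
proof -
  have "tan_part X v w = dir_deriv 0 X v"
    using assms linear_0[OF linear_dX] by (intro tan_part_unique) auto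
  with assms(1) show ?thesis by (simp add: nor_part_def linear_0[OF linear_dX])
qed

lemma inner_nor_part:
  assumes "v \<in> S" "\<And>a. z \<bullet> dir_deriv a X v = 0"
  shows "nor_part X v w \<bullet> z = w \<bullet> z"
  using assms by (simp add: nor_part_eq inner_diff_left inner_diff_right inner_commute[of _ z])

lemma differentiable_metric: "v \<in> S \<Longrightarrow> (\<lambda>v. metric_matrix X v $ i $ j) differentiable (at v)"
  unfolding metric_matrix_nth by (intro differentiable_inner differentiable_X)

lemma differentiable_metric_inv:
  "v \<in> S \<Longrightarrow> (\<lambda>v. matrix_inv (metric_matrix X v) $ i $ j) differentiable (at v)"
  by (rule differentiable_matrix_inv[OF differentiable_metric open_S]) (auto simp: invertible_metric)

lemma differentiable_tan_coeff:
  assumes "u \<in> S" "w differentiable (at u)"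
  shows "(\<lambda>v. tan_coeff v (w v) $ i) differentiable (at u)"
  unfolding tan_coeff_def matrix_vector_mult_def using assms
  by (auto intro!: differentiable_sum differentiable_mult differentiable_metric_inv
      differentiable_inner differentiable_X)

lemma second_ff_dX:
  "v \<in> S \<Longrightarrow> second_ff X v (dir_deriv a X v) (dir_deriv b X v)
     = nor_part X v (dir_deriv a (dir_deriv b X) v)"
  unfolding second_ff_def flat_deriv_def tan_ext_def by (simp add: dir_deriv_def[symmetric]) (simp add: dir_deriv_def[of a])

text \<open>
  The second fundamental form on vectors given by their coordinates; see \<open>second_ff_dX\<close>.
\<close>
definition II :: "real^'n \<Rightarrow> real^'n \<Rightarrow> real^'n \<Rightarrow> 'b" where
  "II v a b = nor_part X v (dir_deriv a (dir_deriv b X) v)"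

lemma nor_part_II: "v \<in> S \<Longrightarrow> nor_part X v (II v a b) = II v a b"
  by (rule nor_part_of_normal) (simp_all add: II_def)

lemma II_commute: "v \<in> S \<Longrightarrow> II v a b = II v b a"
  unfolding II_def by (subst commute_X) auto

lemma bilinear_II:
  assumes "v \<in> S"
  shows "bilinear (II v)"
proof -
  have "linear (\<lambda>b. II v a b)" for a
    unfolding II_def
    using linear_compose[OF _ linear_nor_part[OF assms], of "\<lambda>b. dir_deriv a (dir_deriv b X) v"]
      bilinear_ddX[OF assms] by (simp add: bilinear_def o_def)
  then show ?thesis unfolding bilinear_def using II_commute[OF assms] by simp
qed

text \<open>
  Subtract from \<open>w\<close> its tangential part \<open>\<Sum>\<^sub>i \<alpha>\<^sub>i X\<^sub>i\<close> and differentiate. The terms in which the coefficients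
  \<open>\<alpha>\<^sub>i\<close> are differentiated remain tangent and are killed by the outer projection; those in which the
  coordinate fields \<open>X\<^sub>i\<close> are differentiated give the second fundamental form.
\<close>
lemma nor_part_field_derivative:
  assumes u: "u \<in> S" and w: "w differentiable (at u)"
  shows differentiable_nor_part: "(\<lambda>v. nor_part X v (w v)) differentiable (at u)"
    and nor_part_dir_deriv_nor_part: "nor_part X u (dir_deriv c (\<lambda>v. nor_part X v (w v)) u)
      = nor_part X u (dir_deriv c w u) - II u c (tan_coeff u (w u))"
proof -
  define \<alpha> where "\<alpha> i v = tan_coeff v (w v) $ i" for i v
  define D where "D c = dir_deriv c w u - (\<Sum>i\<in>UNIV. \<alpha> i u *\<^sub>R dir_deriv c (dir_deriv (axis i 1) X) u
      + dir_deriv c (\<alpha> i) u *\<^sub>R dir_deriv (axis i 1) X u)" for c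
  have "((\<lambda>v. w v - (\<Sum>i\<in>UNIV. \<alpha> i v *\<^sub>R dir_deriv (axis i 1) X v)) has_derivative D) (at u)"
    unfolding D_def \<alpha>_def
    by (intro has_derivative_diff has_derivative_sum has_derivative_scaleR has_derivative_dir_deriv
        w differentiable_X differentiable_tan_coeff u)
  moreover have "w v - (\<Sum>i\<in>UNIV. \<alpha> i v *\<^sub>R dir_deriv (axis i 1) X v) = nor_part X v (w v)" if "v \<in> S" for v
    using that linear_axis_expansion[OF linear_dX[OF that], of "tan_coeff v (w v)"]
    by (simp add: nor_part_eq \<alpha>_def)
  ultimately have der: "((\<lambda>v. nor_part X v (w v)) has_derivative D) (at u)"
    by (rule has_derivative_transform_within_open[OF _ open_S u])
  then show "(\<lambda>v. nor_part X v (w v)) differentiable (at u)" by (auto simp: differentiable_def)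
  note lin = linear_nor_part[OF u]
  have "nor_part X u (D c) = nor_part X u (dir_deriv c w u) - (\<Sum>i\<in>UNIV. \<alpha> i u *\<^sub>R II u c (axis i 1))"
    unfolding D_def
    by (simp add: linear_diff[OF lin] linear_sum[OF lin] linear_add[OF lin] linear_scale[OF lin] II_def u)
  also have "(\<Sum>i\<in>UNIV. \<alpha> i u *\<^sub>R II u c (axis i 1)) = II u c (tan_coeff u (w u))"
    using bilinear_II[OF u] linear_axis_expansion[of "II u c" "tan_coeff u (w u)"]
    by (simp add: bilinear_def \<alpha>_def)
  finally show "nor_part X u (dir_deriv c (\<lambda>v. nor_part X v (w v)) u)
      = nor_part X u (dir_deriv c w u) - II u c (tan_coeff u (w u))"
    by (simp add: dir_deriv_eqI[OF der])
qed

section \<open>The Codazzi equation and the derivative of the principal normal\<close>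

lemma tan_ext_dX: "u \<in> S \<Longrightarrow> tan_ext X u (dir_deriv a X u) = dir_deriv a X"
  by (simp add: tan_ext_def) (simp add: dir_deriv_def)

lemma flat_deriv_dX: "u \<in> S \<Longrightarrow> flat_deriv X V u (dir_deriv a X u) = dir_deriv a V u"
  by (simp add: flat_deriv_def) (simp add: dir_deriv_def)

lemma nor_conn_dX: "u \<in> S \<Longrightarrow> nor_conn X V u (dir_deriv a X u) = nor_part X u (dir_deriv a V u)"
  by (simp add: nor_conn_def flat_deriv_dX)

text \<open>
  The coordinates of the Levi-Civita derivative of the constant-coordinate field \<open>b\<close> in direction \<open>a\<close>,
  that is, \<open>\<Gamma>\<^sub>a\<^sub>b\<close>.
\<close>
definition christoffel :: "real^'n \<Rightarrow> real^'n \<Rightarrow> real^'n \<Rightarrow> real^'n" where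
  "christoffel u a b = tan_coeff u (dir_deriv a (dir_deriv b X) u)"

lemma christoffel_commute: "u \<in> S \<Longrightarrow> christoffel u a b = christoffel u b a"
  unfolding christoffel_def by (subst commute_X) auto

lemma bilinear_christoffel:
  assumes "u \<in> S"
  shows "bilinear (christoffel u)"
  using bilinear_ddX[OF assms] unfolding bilinear_def christoffel_def
  by (auto intro: linear_compose[OF _ linear_tan_coeff, unfolded o_def])

lemma tan_conn_dX:
  assumes "u \<in> S"
  shows "tan_conn X (dir_deriv b X) u (dir_deriv a X u) = dir_deriv (christoffel u a b) X u"
  using assms by (simp add: tan_conn_def flat_deriv_dX tan_part_eq christoffel_def)

lemma nor_part_dir_deriv_II:
  assumes "u \<in> S"
  shows "(\<lambda>v. II v a b) differentiable (at u)"
    and "nor_part X u (dir_deriv c (\<lambda>v. II v a b) u)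
      = nor_part X u (dir_deriv c (dir_deriv a (dir_deriv b X)) u) - II u c (christoffel u a b)"
proof -
  note d = differentiable_X(3)[OF assms, of a b]
  show "(\<lambda>v. II v a b) differentiable (at u)"
    unfolding II_def by (rule differentiable_nor_part[OF assms d])
  show "nor_part X u (dir_deriv c (\<lambda>v. II v a b) u)
      = nor_part X u (dir_deriv c (dir_deriv a (dir_deriv b X)) u) - II u c (christoffel u a b)"
    unfolding II_def christoffel_def
    by (rule nor_part_dir_deriv_nor_part[OF assms d, unfolded II_def])
qed

text \<open>
  \<open>(\<nabla>\<^sub>cA)(a, b)\<close> for vectors given by their coordinates.
\<close>
definition nabla_II :: "real^'n \<Rightarrow> real^'n \<Rightarrow> real^'n \<Rightarrow> real^'n \<Rightarrow> 'b" where
  "nabla_II u c a b = nor_part X u (dir_deriv c (\<lambda>v. II v a b) u)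
     - II u (christoffel u c a) b - II u a (christoffel u c b)"

text \<open>
  The Codazzi equation in flat space: substituting \<open>nor_part_dir_deriv_II\<close> turns \<open>(\<nabla>\<^sub>cA)(a, b)\<close> into
  the normal part of \<open>\<partial>\<^sub>c\<partial>\<^sub>a\<partial>\<^sub>bX\<close> minus \<open>A(c, \<Gamma>\<^sub>a\<^sub>b) + A(\<Gamma>\<^sub>c\<^sub>a, b) + A(a, \<Gamma>\<^sub>c\<^sub>b)\<close>, and this is symmetric in
  \<open>a, b, c\<close>.
\<close>
lemma nabla_II_commute:
  assumes "u \<in> S"
  shows "nabla_II u c a b = nabla_II u c b a" "nabla_II u c a b = nabla_II u a c b"
proof -
  show "nabla_II u c a b = nabla_II u c b a"
    unfolding nabla_II_def nor_part_dir_deriv_II(2)[OF assms]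
    by (simp add: commute_X(3)[OF assms, of c a b] christoffel_commute[OF assms, of a b]
        II_commute[OF assms, of "christoffel u c a" b] II_commute[OF assms, of a "christoffel u c b"]
        algebra_simps)
  show "nabla_II u c a b = nabla_II u a c b"
    unfolding nabla_II_def nor_part_dir_deriv_II(2)[OF assms]
    using commute_X(2)[OF assms, of c a b] christoffel_commute[OF assms, of a c]
    by (simp add: algebra_simps)
qed

lemma mean_curv_eq:
  assumes "v \<in> S"
  shows "mean_curv X v = (\<Sum>i\<in>UNIV. \<Sum>j\<in>UNIV. matrix_inv (metric_matrix X v) $ i $ j *\<^sub>R II v (axis i 1) (axis j 1))"
  unfolding mean_curv_def coord_vec_def II_def
  by (simp add: second_ff_dX[OF assms, symmetric]) (simp add: dir_deriv_def)

lemma mean_curv_normal: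
  assumes "v \<in> S"
  shows "mean_curv X v \<bullet> dir_deriv a X v = 0" "principal_normal X v \<bullet> dir_deriv a X v = 0"
    "nor_part X v (principal_normal X v) = principal_normal X v"
proof -
  show *: "mean_curv X v \<bullet> dir_deriv a X v = 0" for a
    using assms by (simp add: mean_curv_eq inner_sum_left II_def)
  show "principal_normal X v \<bullet> dir_deriv a X v = 0" for a
    using * by (simp add: principal_normal_def)
  then show "nor_part X v (principal_normal X v) = principal_normal X v"
    using assms by (simp add: nor_part_of_normal)
qed

lemma differentiable_mean_curv:
  assumes "u \<in> S"
  shows "mean_curv X differentiable (at u)"
proof (rule differentiable_cong_open[OF _ open_S assms])
  show "(\<lambda>v. \<Sum>i\<in>UNIV. \<Sum>j\<in>UNIV. matrix_inv (metric_matrix X v) $ i $ j *\<^sub>R II v (axis i 1) (axis j 1))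
      differentiable (at u)"
    using assms by (auto intro!: differentiable_sum differentiable_scaleR differentiable_metric_inv
        nor_part_dir_deriv_II)
qed (simp add: mean_curv_eq)

lemma differentiable_principal_normal:
  assumes "u \<in> S" "mean_curv X u \<noteq> 0"
  shows "principal_normal X differentiable (at u)"
proof -
  have n: "(\<lambda>v. norm (mean_curv X v)) differentiable (at u)"
    using differentiable_compose[OF differentiable_norm_at differentiable_mean_curv] assms by blast
  have "(\<lambda>v. (1 / norm (mean_curv X v)) *\<^sub>R mean_curv X v) differentiable (at u)"
    using assms n by (intro differentiable_scaleR differentiable_divide differentiable_mean_curv) auto
  then show ?thesis by (simp add: principal_normal_def[abs_def] divide_inverse)
qed

text \<open>
  Differentiate \<open>|\<nu>|\<^sup>2 = 1\<close>, which holds on the open set where \<open>H \<noteq> 0\<close>.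
\<close>
lemma inner_dir_deriv_principal_normal:
  assumes u: "u \<in> S" "mean_curv X u \<noteq> 0"
  shows "dir_deriv c (principal_normal X) u \<bullet> principal_normal X u = 0"
proof -
  let ?\<nu> = "principal_normal X"
  let ?S = "S \<inter> mean_curv X -` (- {0})"
  have "continuous_on S (mean_curv X)"
    by (intro continuous_at_imp_continuous_on ballI differentiable_imp_continuous_within
        differentiable_mean_curv)
  then have S: "open ?S" "u \<in> ?S"
    using u by (auto intro!: continuous_open_preimage open_S)
  have d: "?\<nu> differentiable (at u)" using u by (rule differentiable_principal_normal)
  have "?\<nu> v \<bullet> ?\<nu> v = 1" if "v \<in> ?S" for v
    using that by (simp add: principal_normal_def power2_norm_eq_inner[symmetric] power2_eq_square)
  then have "dir_deriv c (\<lambda>v. ?\<nu> v \<bullet> ?\<nu> v) u = dir_deriv c (\<lambda>v. 1) u"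
    using d by (intro dir_deriv_cong_open[OF _ S] differentiable_inner) auto
  moreover have "dir_deriv c (\<lambda>v. ?\<nu> v \<bullet> ?\<nu> v) u = ?\<nu> u \<bullet> dir_deriv c ?\<nu> u + dir_deriv c ?\<nu> u \<bullet> ?\<nu> u"
    by (rule dir_deriv_eqI) (intro has_derivative_inner has_derivative_dir_deriv d)
  ultimately show ?thesis by (simp add: dir_deriv_def inner_commute)
qed

lemma linear_minus_part: "linear (minus_part X u)"
  by (auto intro!: linearI simp: minus_part_def inner_add_left algebra_simps)

lemma minus_part_principal_normal: "mean_curv X u \<noteq> 0 \<Longrightarrow> minus_part X u (principal_normal X u) = 0"
  by (simp add: minus_part_def principal_normal_def power2_norm_eq_inner[symmetric] power2_eq_square)

lemma minus_part_nor_conn_principal_normal: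
  assumes "u \<in> S" "mean_curv X u \<noteq> 0"
  shows "minus_part X u (nor_part X u (dir_deriv c (principal_normal X) u))
    = nor_part X u (dir_deriv c (principal_normal X) u)"
  using assms by (simp add: minus_part_def inner_nor_part mean_curv_normal inner_dir_deriv_principal_normal)

text \<open>
  The product rule for \<open>H = |H|\<nu>\<close>; the derivative of the factor \<open>|H|\<close> contributes a multiple of \<open>\<nu>\<close>.
\<close>
lemma minus_part_nor_conn_mean_curv:
  assumes u: "u \<in> S" "mean_curv X u \<noteq> 0"
  shows "minus_part X u (nor_part X u (dir_deriv c (mean_curv X) u))
    = norm (mean_curv X u) *\<^sub>R nor_part X u (dir_deriv c (principal_normal X) u)"
proof -
  let ?\<nu> = "principal_normal X"
  have n: "(\<lambda>v. norm (mean_curv X v)) differentiable (at u)"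
    using differentiable_compose[OF differentiable_norm_at differentiable_mean_curv] assms by blast
  have "dir_deriv c (\<lambda>v. norm (mean_curv X v) *\<^sub>R ?\<nu> v) u
     = norm (mean_curv X u) *\<^sub>R dir_deriv c ?\<nu> u + dir_deriv c (\<lambda>v. norm (mean_curv X v)) u *\<^sub>R ?\<nu> u"
    by (rule dir_deriv_eqI)
      (intro has_derivative_scaleR has_derivative_dir_deriv n differentiable_principal_normal u)
  moreover have "(\<lambda>v. norm (mean_curv X v) *\<^sub>R ?\<nu> v) = mean_curv X"
  proof
    show "norm (mean_curv X v) *\<^sub>R ?\<nu> v = mean_curv X v" for v
      by (cases "mean_curv X v = 0") (simp_all add: principal_normal_def)
  qed
  ultimately show ?thesis
    using u by (simp add: linear_add[OF linear_nor_part] linear_scale[OF linear_nor_part]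
        linear_add[OF linear_minus_part] linear_scale[OF linear_minus_part] mean_curv_normal
        minus_part_principal_normal minus_part_nor_conn_principal_normal)
qed

lemma A_minus_dX:
  assumes "v \<in> S"
  shows "A_minus X v (dir_deriv a X v) (dir_deriv b X v)
    = II v a b - (II v a b \<bullet> principal_normal X v) *\<^sub>R principal_normal X v"
  using assms by (simp add: A_minus_def h_form_def second_ff_dX II_def)

text \<open>
  The product rule for \<open>A\<^sup>- = A - h\<nu>\<close>. All terms in which \<open>h\<close> is differentiated or evaluated on
  Levi-Civita derivatives are multiples of \<open>\<nu>\<close>, so the projection removes them and only \<open>h \<nabla>\<nu>\<close>
  survives.
\<close>
lemma minus_part_tensor_conn_A_minus:
  assumes u: "u \<in> S" "mean_curv X u \<noteq> 0"
  shows "minus_part X u (tensor_conn X (A_minus X) u (dir_deriv c X u) (dir_deriv a X u) (dir_deriv b X u))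
    = minus_part X u (nabla_II u c a b)
      - (II u a b \<bullet> principal_normal X u) *\<^sub>R nor_part X u (dir_deriv c (principal_normal X) u)"
proof -
  let ?\<nu> = "principal_normal X"
  note d = has_derivative_dir_deriv[OF differentiable_principal_normal[OF u]]
    has_derivative_dir_deriv[OF nor_part_dir_deriv_II(1)[OF u(1)]]
  \<comment> \<open>The scalar \<open>s\<close> is the derivative of \<open>h(a, b)\<close>.\<close>
  define s where "s = II u a b \<bullet> dir_deriv c ?\<nu> u + dir_deriv c (\<lambda>v. II v a b) u \<bullet> ?\<nu> u"
  have der: "dir_deriv c (\<lambda>v. II v a b - (II v a b \<bullet> ?\<nu> v) *\<^sub>R ?\<nu> v) u
    = dir_deriv c (\<lambda>v. II v a b) u - ((II u a b \<bullet> ?\<nu> u) *\<^sub>R dir_deriv c ?\<nu> u + s *\<^sub>R ?\<nu> u)"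
    unfolding s_def
    by (rule dir_deriv_eqI) (intro has_derivative_diff has_derivative_scaleR has_derivative_inner d)
  have "dir_deriv c (\<lambda>v. A_minus X v (dir_deriv a X v) (dir_deriv b X v)) u
      = dir_deriv c (\<lambda>v. II v a b - (II v a b \<bullet> ?\<nu> v) *\<^sub>R ?\<nu> v) u"
    using d open_S u(1) A_minus_dX
    by (intro dir_deriv_cong_open[symmetric, where S = S] differentiable_diff differentiable_scaleR
        differentiable_inner) (auto simp: differentiable_def)
  then have "tensor_conn X (A_minus X) u (dir_deriv c X u) (dir_deriv a X u) (dir_deriv b X u)
    = nor_part X u (dir_deriv c (\<lambda>v. II v a b) u - ((II u a b \<bullet> ?\<nu> u) *\<^sub>R dir_deriv c ?\<nu> u + s *\<^sub>R ?\<nu> u))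
     - (II u (christoffel u c a) b - (II u (christoffel u c a) b \<bullet> ?\<nu> u) *\<^sub>R ?\<nu> u)
     - (II u a (christoffel u c b) - (II u a (christoffel u c b) \<bullet> ?\<nu> u) *\<^sub>R ?\<nu> u)"
    using u by (simp add: tensor_conn_def tan_ext_dX nor_conn_dX tan_conn_dX A_minus_dX der)
  then show ?thesis
    using u
    by (simp add: nabla_II_def linear_add[OF linear_nor_part] linear_scale[OF linear_nor_part]
        linear_diff[OF linear_nor_part] linear_diff[OF linear_minus_part]
        linear_add[OF linear_minus_part] linear_scale[OF linear_minus_part] mean_curv_normal
        minus_part_principal_normal minus_part_nor_conn_principal_normal)
qed

end

section \<open>Traces in an orthonormal frame\<close>

text \<open>
  An orthonormal frame at \<open>u\<close> is represented by its coordinate vectors, so that each frame vector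
  extends to a field with constant coordinates near \<open>u\<close>.
\<close>
locale immersed_patch_frame = immersed_patch X S
  for X :: "real ^ 'n::finite \<Rightarrow> 'b::euclidean_space" and S +
  fixes u :: "real ^ 'n" and a :: "'n \<Rightarrow> real ^ 'n"
  assumes u: "u \<in> S"
    and orthonormal: "\<And>i j. dir_deriv (a i) X u \<bullet> dir_deriv (a j) X u = (if i = j then 1 else 0)"
begin

text \<open>
  With \<open>P\<close> the matrix whose columns are the vectors \<open>a k\<close>, orthonormality reads \<open>P\<^sup>T g P = 1\<close>. A
  one-sided inverse of a square matrix is two-sided, so \<open>P P\<^sup>T g = 1\<close>.
\<close>
lemma metric_inv_eq: "matrix_inv (metric_matrix X u) $ i $ j = (\<Sum>k\<in>UNIV. a k $ i * a k $ j)"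
proof -
  let ?g = "metric_matrix X u"
  define P :: "real^'n^'n" where "P = (\<chi> i k. a k $ i)"
  have P_axis: "P *v axis k 1 = a k" for k
    by (simp add: vec_eq_iff matrix_vector_mult_basis column_def P_def)
  have "(transpose P ** ?g ** P) $ i $ j = (mat 1 :: real^'n^'n) $ i $ j" for i j
  proof -
    have "(transpose P ** ?g ** P) $ i $ j = axis i 1 \<bullet> ((transpose P ** ?g ** P) *v axis j 1)"
      by (simp add: inner_axis' matrix_vector_mult_basis column_def)
    also have "\<dots> = (P *v axis i 1) \<bullet> (?g *v (P *v axis j 1))"
      by (simp add: matrix_vector_mul_assoc[symmetric] dot_lmul_matrix[symmetric])
        (metis dot_lmul_matrix vector_transpose_matrix transpose_transpose inner_commute)
    also have "\<dots> = (mat 1 :: real^'n^'n) $ i $ j"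
      by (simp add: P_axis inner_metric[OF u] orthonormal mat_def)
    finally show ?thesis .
  qed
  then have "(transpose P ** ?g) ** P = mat 1" by (simp add: vec_eq_iff)
  then have "P ** (transpose P ** ?g) = mat 1" using matrix_left_right_inverse by blast
  then have "P ** transpose P ** ?g = mat 1" by (simp add: matrix_mul_assoc)
  then have "P ** transpose P ** (?g ** matrix_inv ?g) = matrix_inv ?g"
    by (simp add: matrix_mul_assoc)
  then have "P ** transpose P = matrix_inv ?g"
    by (simp add: matrix_inv_inverse invertible_metric u)
  then have "matrix_inv ?g $ i $ j = (P ** transpose P) $ i $ j" by simp
  then show ?thesis by (simp add: matrix_matrix_mult_def transpose_def P_def)
qed

lemma metric_trace:
  fixes f :: "real^'n \<Rightarrow> real^'n \<Rightarrow> 'c::real_vector"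
  assumes "bilinear f"
  shows "(\<Sum>i\<in>UNIV. \<Sum>j\<in>UNIV. matrix_inv (metric_matrix X u) $ i $ j *\<^sub>R f (axis i 1) (axis j 1))
    = (\<Sum>k\<in>UNIV. f (a k) (a k))"
proof -
  have lin: "linear (f x)" "linear (\<lambda>x. f x y)" for x y using assms by (auto simp: bilinear_def)
  have "f (a k) (a k) = (\<Sum>i\<in>UNIV. \<Sum>j\<in>UNIV. (a k $ i * a k $ j) *\<^sub>R f (axis i 1) (axis j 1))" for k
  proof -
    have "f (a k) (a k) = (\<Sum>i\<in>UNIV. a k $ i *\<^sub>R f (axis i 1) (a k))"
      by (rule linear_axis_expansion[OF lin(2)])
    also have "\<dots> = (\<Sum>i\<in>UNIV. a k $ i *\<^sub>R (\<Sum>j\<in>UNIV. a k $ j *\<^sub>R f (axis i 1) (axis j 1)))"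
      using linear_axis_expansion[OF lin(1), of _ "a k"] by simp
    finally show ?thesis by (simp add: scaleR_sum_right)
  qed
  then have "(\<Sum>k\<in>UNIV. f (a k) (a k))
     = (\<Sum>k\<in>UNIV. \<Sum>i\<in>UNIV. \<Sum>j\<in>UNIV. (a k $ i * a k $ j) *\<^sub>R f (axis i 1) (axis j 1))" by simp
  also have "\<dots> = (\<Sum>i\<in>UNIV. \<Sum>k\<in>UNIV. \<Sum>j\<in>UNIV. (a k $ i * a k $ j) *\<^sub>R f (axis i 1) (axis j 1))"
    by (rule sum.swap)
  also have "\<dots> = (\<Sum>i\<in>UNIV. \<Sum>j\<in>UNIV. \<Sum>k\<in>UNIV. (a k $ i * a k $ j) *\<^sub>R f (axis i 1) (axis j 1))"
    by (intro sum.cong refl sum.swap)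
  finally show ?thesis by (simp add: metric_inv_eq scaleR_sum_left)
qed

lemma mean_curv_frame: "mean_curv X u = (\<Sum>k\<in>UNIV. II u (a k) (a k))"
  using metric_trace[OF bilinear_II[OF u]] by (simp add: mean_curv_eq u)

text \<open>
  By \<open>\<partial>\<^sub>c g\<^sub>p\<^sub>q = \<langle>\<partial>\<^sub>cX\<^sub>p, X\<^sub>q\<rangle> + \<langle>X\<^sub>p, \<partial>\<^sub>cX\<^sub>q\<rangle>\<close>, the derivative \<open>- g\<^sup>-\<^sup>1 (\<partial>\<^sub>c g) g\<^sup>-\<^sup>1\<close> of the inverse metric splits
  into two summands. Paired with the symmetric form \<open>A\<close> both give the same value, and raising the
  index of \<open>\<langle>\<partial>\<^sub>cX\<^sub>p, X\<^sub>q\<rangle>\<close> yields the Christoffel coordinates \<open>\<Gamma>\<^sub>c\<^sub>p\<close>.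
\<close>
lemma metric_inv_derivative_trace:
  "(\<Sum>i\<in>UNIV. \<Sum>j\<in>UNIV. dir_deriv c (\<lambda>v. matrix_inv (metric_matrix X v) $ i $ j) u *\<^sub>R II u (axis i 1) (axis j 1))
    = - 2 *\<^sub>R (\<Sum>k\<in>UNIV. II u (a k) (christoffel u c (a k)))"
proof -
  \<comment> \<open>\<open>G\<close> is the inverse metric, \<open>M p q = \<langle>\<partial>\<^sub>cX\<^sub>p, X\<^sub>q\<rangle>\<close>, \<open>F\<close> is \<open>A\<close> in coordinates, and \<open>T N\<close> is the
    full contraction of \<open>G N G\<close> with \<open>F\<close>.\<close>
  define G where "G i j = matrix_inv (metric_matrix X u) $ i $ j" for i j
  define M where "M i j = dir_deriv c (dir_deriv (axis i 1) X) u \<bullet> dir_deriv (axis j 1) X u" for i j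
  define F where "F i j = II u (axis i 1) (axis j 1)" for i j :: 'n
  define T where "T N = (\<Sum>i\<in>UNIV. \<Sum>j\<in>UNIV. (\<Sum>p\<in>UNIV. \<Sum>q\<in>UNIV. G i p * N p q * G q j) *\<^sub>R F i j)"
    for N :: "'n \<Rightarrow> 'n \<Rightarrow> real"
  have sym: "G i j = G j i" "F i j = F j i" for i j
    by (auto simp: G_def metric_inv_eq mult.commute F_def II_commute[OF u])
  have dg: "dir_deriv c (\<lambda>v. metric_matrix X v $ p $ q) u = M p q + M q p" for p q
    unfolding metric_matrix_nth M_def
    by (rule trans[OF dir_deriv_eqI[OF has_derivative_inner[OF has_derivative_dir_deriv
              has_derivative_dir_deriv]]]) (auto simp: differentiable_X u inner_commute)
  have dG: "dir_deriv c (\<lambda>v. matrix_inv (metric_matrix X v) $ i $ j) u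
      = - (\<Sum>p\<in>UNIV. \<Sum>q\<in>UNIV. G i p * (M p q + M q p) * G q j)" for i j
    using dir_deriv_matrix_inv[OF differentiable_metric open_S u invertible_metric, of c i j] u
    by (simp add: G_def dg)
  have chr: "christoffel u c (axis p 1) $ j = (\<Sum>q\<in>UNIV. G j q * M p q)" for p j
    by (simp add: christoffel_def tan_coeff_def matrix_vector_mult_def G_def M_def)
  have "T (\<lambda>p q. M q p) = (\<Sum>j\<in>UNIV. \<Sum>i\<in>UNIV. (\<Sum>p\<in>UNIV. \<Sum>q\<in>UNIV. G i p * M q p * G q j) *\<^sub>R F i j)"
    unfolding T_def by (rule sum.swap)
  also have "\<dots> = (\<Sum>j\<in>UNIV. \<Sum>i\<in>UNIV. (\<Sum>q\<in>UNIV. \<Sum>p\<in>UNIV. G i p * M q p * G q j) *\<^sub>R F i j)"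
    by (intro sum.cong refl arg_cong2[where f = scaleR] sum.swap)
  also have "\<dots> = T M"
  proof -
    have "G i p * M q p * G q j = G j q * M q p * G p i" for i j p q
      using sym(1)[of i p] sym(1)[of q j] by (simp add: mult_ac)
    then have "(\<Sum>q\<in>UNIV. \<Sum>p\<in>UNIV. G i p * M q p * G q j) *\<^sub>R F i j
        = (\<Sum>q\<in>UNIV. \<Sum>p\<in>UNIV. G j q * M q p * G p i) *\<^sub>R F j i" for i j
      by (intro arg_cong2[where f = scaleR] sum.cong refl sym(2))
    then show ?thesis unfolding T_def by (intro sum.cong refl)
  qed
  finally have TM: "T (\<lambda>p q. M q p) = T M" .
  have "T M = (\<Sum>i\<in>UNIV. \<Sum>j\<in>UNIV. \<Sum>p\<in>UNIV. G i p *\<^sub>R ((\<Sum>q\<in>UNIV. G j q * M p q) *\<^sub>R F i j))"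
  proof -
    have *: "(\<Sum>p\<in>UNIV. \<Sum>q\<in>UNIV. G i p * M p q * G q j) = (\<Sum>p\<in>UNIV. G i p * (\<Sum>q\<in>UNIV. G j q * M p q))"
      for i j by (simp add: sum_distrib_left sym(1)[of j] mult_ac)
    show ?thesis
      unfolding T_def * by (intro sum.cong refl) (subst scaleR_sum_left, simp)
  qed
  also have "\<dots> = (\<Sum>i\<in>UNIV. \<Sum>p\<in>UNIV. \<Sum>j\<in>UNIV. G i p *\<^sub>R ((\<Sum>q\<in>UNIV. G j q * M p q) *\<^sub>R F i j))"
    by (intro sum.cong refl sum.swap)
  also have "\<dots> = (\<Sum>i\<in>UNIV. \<Sum>p\<in>UNIV. G i p *\<^sub>R II u (axis i 1) (christoffel u c (axis p 1)))"
  proof (intro sum.cong refl)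
    fix i p
    have "II u (axis i 1) (christoffel u c (axis p 1)) = (\<Sum>j\<in>UNIV. (\<Sum>q\<in>UNIV. G j q * M p q) *\<^sub>R F i j)"
      using linear_axis_expansion[of "II u (axis i 1)" "christoffel u c (axis p 1)"] bilinear_II[OF u]
      by (simp add: bilinear_def chr F_def)
    then show "(\<Sum>j\<in>UNIV. G i p *\<^sub>R ((\<Sum>q\<in>UNIV. G j q * M p q) *\<^sub>R F i j))
        = G i p *\<^sub>R II u (axis i 1) (christoffel u c (axis p 1))"
      by (simp only: scaleR_sum_right)
  qed
  also have "\<dots> = (\<Sum>k\<in>UNIV. II u (a k) (christoffel u c (a k)))"
    unfolding G_def
  proof (rule metric_trace)
    show "bilinear (\<lambda>x y. II u x (christoffel u c y))"
      using bilinear_II[OF u] bilinear_christoffel[OF u]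
      unfolding bilinear_def
      by (auto intro: linear_compose[of "christoffel u c", unfolded o_def])
  qed
  finally have T: "T M = (\<Sum>k\<in>UNIV. II u (a k) (christoffel u c (a k)))" .
  have "(\<Sum>i\<in>UNIV. \<Sum>j\<in>UNIV. dir_deriv c (\<lambda>v. matrix_inv (metric_matrix X v) $ i $ j) u *\<^sub>R II u (axis i 1) (axis j 1))
     = - (T M + T (\<lambda>p q. M q p))"
    unfolding dG T_def F_def
    by (simp add: distrib_left distrib_right sum.distrib scaleR_diff_left sum_subtractf sum_negf)
  also have "\<dots> = - 2 *\<^sub>R T M" by (simp add: TM scaleR_2)
  finally show ?thesis by (simp add: T)
qed

text \<open>
  Taking the trace commutes with covariant differentiation: by \<open>metric_inv_derivative_trace\<close>, the
  derivative of the inverse metric in \<open>H = g\<^sup>i\<^sup>j A\<^sub>i\<^sub>j\<close> supplies precisely the Christoffel terms of \<open>\<nabla>\<^sub>cA\<close>.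
\<close>
lemma nor_part_dir_deriv_mean_curv:
  "nor_part X u (dir_deriv c (mean_curv X) u) = (\<Sum>k\<in>UNIV. nabla_II u c (a k) (a k))"
proof -
  let ?G = "\<lambda>v i j. matrix_inv (metric_matrix X v) $ i $ j"
  let ?F = "\<lambda>v i j. II v (axis i 1) (axis j 1)"
  note lin = linear_nor_part[OF u]
  have "dir_deriv c (mean_curv X) u = dir_deriv c (\<lambda>v. \<Sum>i\<in>UNIV. \<Sum>j\<in>UNIV. ?G v i j *\<^sub>R ?F v i j) u"
    by (rule dir_deriv_cong_open[OF _ open_S u]) (auto simp: mean_curv_eq differentiable_mean_curv u)
  also have "\<dots> = (\<Sum>i\<in>UNIV. \<Sum>j\<in>UNIV. ?G u i j *\<^sub>R dir_deriv c (\<lambda>v. ?F v i j) u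
       + dir_deriv c (\<lambda>v. ?G v i j) u *\<^sub>R ?F u i j)"
    by (rule dir_deriv_eqI) (intro has_derivative_sum has_derivative_scaleR has_derivative_dir_deriv
        nor_part_dir_deriv_II differentiable_metric_inv u)
  finally have "nor_part X u (dir_deriv c (mean_curv X) u)
    = (\<Sum>i\<in>UNIV. \<Sum>j\<in>UNIV. ?G u i j *\<^sub>R nor_part X u (dir_deriv c (\<lambda>v. ?F v i j) u))
      + (\<Sum>i\<in>UNIV. \<Sum>j\<in>UNIV. dir_deriv c (\<lambda>v. ?G v i j) u *\<^sub>R nor_part X u (?F u i j))"
    by (simp add: linear_sum[OF lin] linear_add[OF lin] linear_scale[OF lin] sum.distrib)
  also have "(\<Sum>i\<in>UNIV. \<Sum>j\<in>UNIV. ?G u i j *\<^sub>R nor_part X u (dir_deriv c (\<lambda>v. ?F v i j) u))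
    = (\<Sum>k\<in>UNIV. nor_part X u (dir_deriv c (\<lambda>v. II v (a k) (a k)) u))"
  proof (rule metric_trace[where f = "\<lambda>x y. nor_part X u (dir_deriv c (\<lambda>v. II v x y) u)"])
    show "bilinear (\<lambda>x y. nor_part X u (dir_deriv c (\<lambda>v. II v x y) u))"
      unfolding nor_part_dir_deriv_II(2)[OF u] bilinear_def
    proof (intro conjI allI linear_compose_sub)
      fix x
      show "linear (\<lambda>y. nor_part X u (dir_deriv c (dir_deriv x (dir_deriv y X)) u))"
        and "linear (\<lambda>y. nor_part X u (dir_deriv c (dir_deriv y (dir_deriv x X)) u))"
        using bilinear_dddX[OF u, of c] linear_compose[OF _ lin, unfolded o_def]
        unfolding bilinear_def by blast+
      have "linear (II u c)" using bilinear_II[OF u] by (simp add: bilinear_def)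
      then show "linear (\<lambda>y. II u c (christoffel u x y))" "linear (\<lambda>y. II u c (christoffel u y x))"
        using bilinear_christoffel[OF u] linear_compose[of _ "II u c", unfolded o_def]
        unfolding bilinear_def by blast+
    qed
  qed
  also have "(\<Sum>i\<in>UNIV. \<Sum>j\<in>UNIV. dir_deriv c (\<lambda>v. ?G v i j) u *\<^sub>R nor_part X u (?F u i j))
    = - 2 *\<^sub>R (\<Sum>k\<in>UNIV. II u (a k) (christoffel u c (a k)))"
    by (simp only: nor_part_II[OF u] metric_inv_derivative_trace)
  also have "(\<Sum>k\<in>UNIV. nor_part X u (dir_deriv c (\<lambda>v. II v (a k) (a k)) u))
     + - 2 *\<^sub>R (\<Sum>k\<in>UNIV. II u (a k) (christoffel u c (a k))) = (\<Sum>k\<in>UNIV. nabla_II u c (a k) (a k))"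
    by (simp add: nabla_II_def sum_subtractf II_commute[OF u, of "christoffel u c _"] scaleR_2)
  finally show ?thesis .
qed

section \<open>The estimate\<close>

text \<open>
  The traces of \<open>C\<^sub>i\<^sub>j\<^sub>k = B\<^sub>i\<^sub>j\<^sub>k - h\<^sub>j\<^sub>k V\<^sub>i\<close> follow from the symmetry of \<open>B\<close> and its trace \<open>|H| V\<close>, and the
  algebraic bound applies to them.
\<close>
theorem nabla_A_minus_bound:
  fixes lam :: "'n \<Rightarrow> real" and n :: real
  assumes n: "n = real CARD('n)" "CARD('n) \<ge> 2"
    and H: "mean_curv X u \<noteq> 0"
    and diagonal: "\<And>i j. II u (a i) (a j) \<bullet> principal_normal X u = (if i = j then lam i else 0)"
  shows "2 * n / ((n + 2) * (n - 1)) *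
      (\<Sum>k\<in>UNIV. (norm (mean_curv X u) - lam k)\<^sup>2 *
        (norm (nor_part X u (dir_deriv (a k) (principal_normal X) u)))\<^sup>2)
    \<le> (\<Sum>i\<in>UNIV. \<Sum>j\<in>UNIV. \<Sum>k\<in>UNIV. (norm (minus_part X u (tensor_conn X (A_minus X) u
        (dir_deriv (a i) X u) (dir_deriv (a j) X u) (dir_deriv (a k) X u))))\<^sup>2)"
proof -
  let ?H = "norm (mean_curv X u)"
  define V where "V i = nor_part X u (dir_deriv (a i) (principal_normal X) u)" for i
  define B where "B i j k = minus_part X u (nabla_II u (a i) (a j) (a k))" for i j k
  define C where "C i j k = B i j k - (if j = k then lam j else 0) *\<^sub>R V i" for i j k
  have B_sym: "B i j k = B i k j" "B i j k = B j i k" for i j k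
    unfolding B_def by (metis nabla_II_commute u)+
  have B_trace: "(\<Sum>k\<in>UNIV. B i k k) = ?H *\<^sub>R V i" for i
    using minus_part_nor_conn_mean_curv[OF u H, of "a i"]
    by (simp add: B_def V_def nor_part_dir_deriv_mean_curv linear_sum[OF linear_minus_part])
  have "(\<Sum>k\<in>UNIV. lam k) = mean_curv X u \<bullet> principal_normal X u"
    by (simp add: mean_curv_frame inner_sum_left diagonal)
  also have "\<dots> = ?H" using H
    by (simp add: principal_normal_def power2_norm_eq_inner[symmetric] power2_eq_square)
  finally have lam: "(\<Sum>k\<in>UNIV. lam k) = ?H" .
  have "2 * n / ((n + 2) * (n - 1)) * (\<Sum>k\<in>UNIV. (norm ((?H - lam k) *\<^sub>R V k))\<^sup>2)
      \<le> (\<Sum>i\<in>UNIV. \<Sum>j\<in>UNIV. \<Sum>k\<in>UNIV. (norm (C i j k))\<^sup>2)"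
  proof (rule three_tensor_norm_ge_traces[OF n])
    show "(\<Sum>k\<in>UNIV. C i k k) = 0" for i
      by (simp add: C_def sum_subtractf B_trace lam flip: scaleR_sum_left)
    have "C i i k = B k i i - (if i = k then lam k *\<^sub>R V k else 0)" for i k
      using B_sym(1)[of i i k] B_sym(2)[of i k i] by (simp add: C_def)
    then show *: "(\<Sum>i\<in>UNIV. C i i k) = (?H - lam k) *\<^sub>R V k" for k
      by (simp add: sum_subtractf B_trace scaleR_diff_left)
    have "C i k i = C i i k" for i k
      using B_sym(1)[of i k i] by (simp add: C_def)
    with * show "(\<Sum>i\<in>UNIV. C i k i) = (?H - lam k) *\<^sub>R V k" for k by simp
  qed
  moreover have "minus_part X u (tensor_conn X (A_minus X) u
        (dir_deriv (a i) X u) (dir_deriv (a j) X u) (dir_deriv (a k) X u)) = C i j k" for i j k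
    using minus_part_tensor_conn_A_minus[OF u H] by (simp add: C_def B_def V_def diagonal)
  ultimately show ?thesis by (simp add: power_mult_distrib V_def)
qed

end

theorem proposition4p1:
  fixes M :: "'m topology"
    and \<A> :: "('m, 'n::finite) chart set"
    and F :: "'m \<Rightarrow> 'b::euclidean_space"
    and X :: "real ^ 'n \<Rightarrow> 'b"
    and e :: "'n \<Rightarrow> 'b"
    and lam :: "'n \<Rightarrow> real"
    and n :: real
  assumes n_def: "n = real CARD('n)"
    and "CARD('n) \<ge> 2"
    and "immersed_submanifold M \<A> F"
    and "(U, \<phi>) \<in> \<A>" and "p \<in> U"
    and X_def: "X = F \<circ> inv_into U \<phi>" and u_def: "u = \<phi> p"
    and "norm (mean_curv X u) > 0"
    and "orthonormal_tangent_frame X u e"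
    and "\<And>i j. h_form X u (e i) (e j) = (if i = j then lam i else 0)"
  shows "(\<Sum>i\<in>UNIV. \<Sum>j\<in>UNIV. \<Sum>k\<in>UNIV.
            (norm (minus_part X u (tensor_conn X (A_minus X) u (e i) (e j) (e k))))\<^sup>2)
         \<ge> 2 * n / ((n + 2) * (n - 1)) *
           (\<Sum>i\<in>UNIV. (norm (mean_curv X u) - lam i)\<^sup>2 *
              (norm (nor_conn X (principal_normal X) u (e i)))\<^sup>2)"
proof -
  have man: "smooth_manifold M \<A>" "smooth_immersion \<A> F"
    using assms(3) by (auto simp: immersed_submanifold_def)
  have "open (\<phi> ` U)"
    using man(1) assms(4) by (auto simp: smooth_manifold_def)
  moreover have "smooth_on X (\<phi> ` U)" "\<And>v. v \<in> \<phi> ` U \<Longrightarrow> inj (frechet_derivative X (at v))"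
    using man(2) assms(4) unfolding X_def smooth_immersion_def by auto
  ultimately interpret immersed_patch X "\<phi> ` U"
    by unfold_locales (auto simp: smooth_on_def)
  have u: "u \<in> \<phi> ` U" using \<open>p \<in> U\<close> u_def by simp
  have "\<forall>i. \<exists>a. e i = dir_deriv a X u"
    using assms(9) by (auto simp: orthonormal_tangent_frame_def tangent_space_eq)
  then obtain a where e: "e = (\<lambda>i. dir_deriv (a i) X u)" by metis
  interpret immersed_patch_frame X "\<phi> ` U" u a
    using assms(9) u unfolding e orthonormal_tangent_frame_def by unfold_locales auto
  have "II u (a i) (a j) \<bullet> principal_normal X u = (if i = j then lam i else 0)" for i j
    using assms(10)[of i j] u by (simp add: e h_form_def second_ff_dX II_def)
  from nabla_A_minus_bound[OF assms(1,2) _ this] assms(8) show ?thesis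
    by (simp add: e nor_conn_dX u)
qed

end
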